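(* Let $(M,\varphi,\xi,\eta,g)$ be a 3-dimensional Sasaki-like almost contact B-metric manifold and let $(C(t),\overline{\mathbf F})$ be a Legendre null curve in $M$ with $b=g(\dot C,\varphi\dot C)$, equipped with the Frenet frame $\overline{\mathbf F}=\{\dot C,\overline N,\overline W\}$, where $\overline W=\epsilon_1\epsilon\left(\xi+\frac{\dot b}{2b^2}\dot C\right)$, $\epsilon,\epsilon_1\in\{1,-1\}$, and with curvatures $\bar k_1,\bar k_2$. Then: (i) $(C(t),\overline{\mathbf F})$ has constant curvatures $\bar k_1$ and $\bar k_2$ if and only if $b$ is a nonzero constant. (ii) For a nonzero constant $b$ one has $\bar k_2=0$. (iii) $(C(t),\overline{\mathbf F})$ is a null cubic if and only if $\epsilon_1\epsilon b=1$.
   Context: A 3-dimensional almost contact B-metric manifold $(M,\varphi,\xi,\eta,g)$ is a smooth 3-manifold with an endomorphism $\varphi$ of $TM$, a vector field $\xi$, a 1-form $\eta$ and a pseudo-Riemannian metric $g$ (necessarily of signature $(+,+,-)$) such that $\varphi^2X=-X+\eta(X)\xi$, $\eta(\xi)=1$, $g(\varphi X,\varphi Y)=-g(X,Y)+\eta(X)\eta(Y)$. Consequences: $\eta\circ\varphi=0$, $\varphi\xi=0$, $\eta(X)=g(X,\xi)$. With $\nabla$ the Levi-Civita connection of $g$, it is Sasaki-like if $(\nabla_X\varphi)Y=-g(X,Y)\xi-\eta(Y)X+2\eta(X)\eta(Y)\xi$ (then $\nabla_X\xi=-\varphi X$). A smooth curve $C:I\to M$ ($I$ an interval) is null if $g(\dot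 C,\dot C)=0$ and $\dot C\neq 0$ on $I$; it is Legendre if $\eta(\dot C)=0$. Put $b=g(\dot C,\varphi\dot C)$, $\dot b=db/dt$; for a Legendre null curve $b$ is nowhere zero. A general Frenet frame along a null curve $C$ is $\{\dot C,N,W\}$ with $g(\dot C,N)=g(W,W)=1$, $g(N,N)=g(N,W)=g(\dot C,W)=0$; for given $W$ the field $N$ is unique. The Frenet equations are $\nabla_{\dot C}\dot C=h\dot C+k_1W$, $\nabla_{\dot C}N=-hN+k_2W$, $\nabla_{\dot C}W=-k_2\dot C-k_1N$, defining $h,k_1,k_2$. The parameter is distinguished if $h=0$. For the frame $\overline{\mathbf F}$ one has $\bar h=0$, i.e. $\nabla_{\dot C}\dot C=\bar k_1\overline W$ and $\nabla_{\dot C}\overline N=\bar k_2\overline W$. A null Cartan curve is a null curve with distinguished parameter and Frenet frame with $h=0$, $k_1=1$; then $k_2$ is called its Cartan curvature. A null Cartan helix is a null Cartan curve with constant Cartan curvature; a null cubic is a null Cartan helix with zero Cartan curvature. For $(C,\overline{\mathbf F})$ these notions refer to the frame $\overline{\mathbf F}$ and $\bar k_1,\bar k_2$. *)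

theory Defs
  imports "HOL-Analysis.Analysis" "HOL-Library.Function_Algebras"
begin

section \<open>Smoothness on subsets of Euclidean space\<close>

(* Derivatives are taken within S.  They are unique when S is open, and also when S is a
   relatively open subset of a nondegenerate interval of the real line (one-sided derivatives at
   end points); these are the only two uses below. *)

primrec Ck_on :: "nat \<Rightarrow> 'a::euclidean_space set \<Rightarrow> ('a \<Rightarrow> 'b::real_normed_vector) \<Rightarrow> bool" where
  "Ck_on 0 S f \<longleftrightarrow> continuous_on S f"
| "Ck_on (Suc k) S f \<longleftrightarrow>
     (\<exists>f'. (\<forall>x\<in>S. (f has_derivative f' x) (at x within S)) \<and> (\<forall>v. Ck_on k S (\<lambda>x. f' x v)))"

definition smooth_on :: "'a::euclidean_space set \<Rightarrow> ('a \<Rightarrow> 'b::real_normed_vector) \<Rightarrow> bool" where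
  "smooth_on S f \<longleftrightarrow> (\<forall>k. Ck_on k S f)"


section \<open>Smooth manifolds\<close>

(* A chart is a pair (U, x) of a coordinate domain and a coordinate map. *)
type_synonym ('m, 'e) chart = "'m set \<times> ('m \<Rightarrow> 'e)"

abbreviation cdom :: "('m, 'e) chart \<Rightarrow> 'm set" where "cdom c \<equiv> fst c"
abbreviation cmap :: "('m, 'e) chart \<Rightarrow> 'm \<Rightarrow> 'e" where "cmap c \<equiv> snd c"

definition cinv :: "('m, 'e) chart \<Rightarrow> 'e \<Rightarrow> 'm" where
  "cinv c = inv_into (cdom c) (cmap c)"

definition is_chart :: "('m::topological_space, 'e::euclidean_space) chart \<Rightarrow> bool" where
  "is_chart c \<longleftrightarrow> open (cdom c) \<and> open (cmap c ` cdom c) \<and>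
     homeomorphism (cdom c) (cmap c ` cdom c) (cmap c) (cinv c)"

definition smooth_atlas :: "('m::{t2_space, second_countable_topology}, 'e::euclidean_space) chart set \<Rightarrow> bool" where
  "smooth_atlas A \<longleftrightarrow> (\<forall>c\<in>A. is_chart c) \<and>
     (\<forall>c\<in>A. \<forall>c'\<in>A. smooth_on (cmap c ` (cdom c \<inter> cdom c')) (cmap c' \<circ> cinv c))"

(* The manifold M itself. *)
definition carrier :: "('m, 'e) chart set \<Rightarrow> 'm set" where
  "carrier A = (\<Union>c\<in>A. cdom c)"

definition charts_at :: "('m, 'e) chart set \<Rightarrow> 'm \<Rightarrow> ('m, 'e) chart set" where
  "charts_at A p = {c\<in>A. p \<in> cdom c}"


section \<open>Tangent vectors\<close>

(* A tangent vector at p is given by its coordinate vectors in all the charts around p, related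
   to each other by the Jacobians of the transition maps.  It is set to 0 on charts not around p,
   so that distinct functions are distinct tangent vectors. *)
type_synonym ('m, 'e) tvec = "('m, 'e) chart \<Rightarrow> 'e"

definition of_components ::
  "('m, 'e::euclidean_space) chart set \<Rightarrow> 'm \<Rightarrow> (('m, 'e) chart \<Rightarrow> 'e) \<Rightarrow> ('m, 'e) tvec" where
  "of_components A p w = (\<lambda>c. if c \<in> charts_at A p then w c else 0)"

definition transition_deriv ::
  "('m, 'e::euclidean_space) chart \<Rightarrow> ('m, 'e) chart \<Rightarrow> 'm \<Rightarrow> 'e \<Rightarrow> 'e" where
  "transition_deriv c c' p = frechet_derivative (cmap c' \<circ> cinv c) (at (cmap c p))"

definition tangent_space ::
  "('m, 'e::euclidean_space) chart set \<Rightarrow> 'm \<Rightarrow> ('m, 'e) tvec set" where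
  "tangent_space A p =
     {v. (\<forall>c\<in>charts_at A p. \<forall>c'\<in>charts_at A p. v c' = transition_deriv c c' p (v c)) \<and>
         (\<forall>c. c \<notin> charts_at A p \<longrightarrow> v c = 0)}"

instantiation "fun" :: (type, real_vector) real_vector
begin

definition scaleR_fun :: "real \<Rightarrow> ('a \<Rightarrow> 'b) \<Rightarrow> 'a \<Rightarrow> 'b" where
  "scaleR_fun r f = (\<lambda>x. r *\<^sub>R f x)"

instance
  by standard (auto simp: scaleR_fun_def fun_eq_iff scaleR_add_left scaleR_add_right)

end

(* Linearity of a map defined on a linear subspace V only. *)
definition lin_on :: "'a::real_vector set \<Rightarrow> ('a \<Rightarrow> 'b::real_vector) \<Rightarrow> bool" where
  "lin_on V f \<longleftrightarrow> (\<forall>u\<in>V. \<forall>v\<in>V. \<forall>a b. f (a *\<^sub>R u + b *\<^sub>R v) = a *\<^sub>R f u + b *\<^sub>R f v)"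


section \<open>Functions, vector fields and tensor fields\<close>

definition smooth_function ::
  "('m::topological_space, 'e::euclidean_space) chart set \<Rightarrow> 'm set \<Rightarrow> ('m \<Rightarrow> real) \<Rightarrow> bool" where
  "smooth_function A U f \<longleftrightarrow> (\<forall>c\<in>A. smooth_on (cmap c ` (U \<inter> cdom c)) (f \<circ> cinv c))"

definition smooth_vector_field ::
  "('m::topological_space, 'e::euclidean_space) chart set \<Rightarrow> 'm set \<Rightarrow> ('m \<Rightarrow> ('m, 'e) tvec) \<Rightarrow> bool" where
  "smooth_vector_field A U X \<longleftrightarrow> (\<forall>p\<in>U. X p \<in> tangent_space A p) \<and>
     (\<forall>c\<in>A. smooth_on (cmap c ` (U \<inter> cdom c)) (\<lambda>x. X (cinv c x) c))"

definition open_in :: "('m::topological_space, 'e) chart set \<Rightarrow> 'm set \<Rightarrow> bool" where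
  "open_in A U \<longleftrightarrow> open U \<and> U \<subseteq> carrier A"

(* Tensor fields are pointwise (multi)linear, and smooth in the sense that they send smooth
   (local) vector fields to smooth vector fields or functions. *)

definition endomorphism_field ::
  "('m::topological_space, 'e::euclidean_space) chart set \<Rightarrow>
   ('m \<Rightarrow> ('m, 'e) tvec \<Rightarrow> ('m, 'e) tvec) \<Rightarrow> bool" where
  "endomorphism_field A \<phi> \<longleftrightarrow>
     (\<forall>p\<in>carrier A. lin_on (tangent_space A p) (\<phi> p) \<and>
        (\<forall>v\<in>tangent_space A p. \<phi> p v \<in> tangent_space A p)) \<and>
     (\<forall>U X. open_in A U \<and> smooth_vector_field A U X \<longrightarrow>
        smooth_vector_field A U (\<lambda>p. \<phi> p (X p)))"

definition one_form ::
  "('m::topological_space, 'e::euclidean_space) chart set \<Rightarrow> ('m \<Rightarrow> ('m, 'e) tvec \<Rightarrow> real) \<Rightarrow> bool" where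
  "one_form A \<eta> \<longleftrightarrow>
     (\<forall>p\<in>carrier A. lin_on (tangent_space A p) (\<eta> p)) \<and>
     (\<forall>U X. open_in A U \<and> smooth_vector_field A U X \<longrightarrow> smooth_function A U (\<lambda>p. \<eta> p (X p)))"

definition pseudo_riemannian_metric ::
  "('m::topological_space, 'e::euclidean_space) chart set \<Rightarrow>
   ('m \<Rightarrow> ('m, 'e) tvec \<Rightarrow> ('m, 'e) tvec \<Rightarrow> real) \<Rightarrow> bool" where
  "pseudo_riemannian_metric A g \<longleftrightarrow>
     (\<forall>p\<in>carrier A.
        (\<forall>u\<in>tangent_space A p. lin_on (tangent_space A p) (g p u)) \<and>
        (\<forall>u\<in>tangent_space A p. \<forall>v\<in>tangent_space A p. g p u v = g p v u) \<and>
        (\<forall>u\<in>tangent_space A p. (\<forall>v\<in>tangent_space A p. g p u v = 0) \<longrightarrow> u = 0)) \<and>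
     (\<forall>U X Y. open_in A U \<and> smooth_vector_field A U X \<and> smooth_vector_field A U Y \<longrightarrow>
        smooth_function A U (\<lambda>p. g p (X p) (Y p)))"


section \<open>The Levi-Civita connection\<close>

(* v(f) for a tangent vector v at p; independent of the chart chosen. *)
definition dir_deriv ::
  "('m, 'e::euclidean_space) chart set \<Rightarrow> 'm \<Rightarrow> ('m, 'e) tvec \<Rightarrow> ('m \<Rightarrow> real) \<Rightarrow> real" where
  "dir_deriv A p v f =
     (let c = (SOME c. c \<in> charts_at A p) in frechet_derivative (f \<circ> cinv c) (at (cmap c p)) (v c))"

definition lie_bracket ::
  "('m, 'e::euclidean_space) chart set \<Rightarrow> ('m \<Rightarrow> ('m, 'e) tvec) \<Rightarrow> ('m \<Rightarrow> ('m, 'e) tvec) \<Rightarrow>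
   'm \<Rightarrow> ('m, 'e) tvec" where
  "lie_bracket A X Y p = of_components A p (\<lambda>c.
     frechet_derivative (\<lambda>x. Y (cinv c x) c) (at (cmap c p)) (X p c) -
     frechet_derivative (\<lambda>x. X (cinv c x) c) (at (cmap c p)) (Y p c))"

(* nabla p v Y is the covariant derivative at p of Y, a vector field that is smooth near p, in the
   direction of the tangent vector v at p.  Vector fields are total functions, so that the last
   clause says that the derivative does not depend on the values outside a neighbourhood of p. *)
definition affine_connection ::
  "('m::topological_space, 'e::euclidean_space) chart set \<Rightarrow>
   ('m \<Rightarrow> ('m, 'e) tvec \<Rightarrow> ('m \<Rightarrow> ('m, 'e) tvec) \<Rightarrow> ('m, 'e) tvec) \<Rightarrow> bool" where
  "affine_connection A nabla \<longleftrightarrow>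
     (\<forall>U Y. open_in A U \<and> smooth_vector_field A U Y \<longrightarrow>
        (\<forall>p\<in>U. lin_on (tangent_space A p) (\<lambda>v. nabla p v Y) \<and>
           (\<forall>v\<in>tangent_space A p. nabla p v Y \<in> tangent_space A p)) \<and>
        (\<forall>X. smooth_vector_field A U X \<longrightarrow> smooth_vector_field A U (\<lambda>p. nabla p (X p) Y)) \<and>
        (\<forall>Z. smooth_vector_field A U Z \<longrightarrow> (\<forall>p\<in>U. \<forall>v\<in>tangent_space A p.
           nabla p v (\<lambda>q. Y q + Z q) = nabla p v Y + nabla p v Z)) \<and>
        (\<forall>f. smooth_function A U f \<longrightarrow> (\<forall>p\<in>U. \<forall>v\<in>tangent_space A p.
           nabla p v (\<lambda>q. f q *\<^sub>R Y q) = dir_deriv A p v f *\<^sub>R Y p + f p *\<^sub>R nabla p v Y)) \<and>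
        (\<forall>Z. (\<forall>q\<in>U. Z q = Y q) \<longrightarrow> (\<forall>p\<in>U. \<forall>v\<in>tangent_space A p. nabla p v Z = nabla p v Y)))"

definition levi_civita ::
  "('m::topological_space, 'e::euclidean_space) chart set \<Rightarrow>
   ('m \<Rightarrow> ('m, 'e) tvec \<Rightarrow> ('m, 'e) tvec \<Rightarrow> real) \<Rightarrow>
   ('m \<Rightarrow> ('m, 'e) tvec \<Rightarrow> ('m \<Rightarrow> ('m, 'e) tvec) \<Rightarrow> ('m, 'e) tvec) \<Rightarrow> bool" where
  "levi_civita A g nabla \<longleftrightarrow> affine_connection A nabla \<and>
     (\<forall>U X Y. open_in A U \<and> smooth_vector_field A U X \<and> smooth_vector_field A U Y \<longrightarrow>
        (\<forall>p\<in>U. nabla p (X p) Y - nabla p (Y p) X = lie_bracket A X Y p) \<and>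
        (\<forall>p\<in>U. \<forall>v\<in>tangent_space A p. dir_deriv A p v (\<lambda>q. g q (X q) (Y q)) =
           g p (nabla p v X) (Y p) + g p (X p) (nabla p v Y)))"


section \<open>Sasaki-like almost contact B-metric manifolds\<close>

definition almost_contact_B_metric ::
  "('m::topological_space, 'e::euclidean_space) chart set \<Rightarrow>
   ('m \<Rightarrow> ('m, 'e) tvec \<Rightarrow> ('m, 'e) tvec) \<Rightarrow> ('m \<Rightarrow> ('m, 'e) tvec) \<Rightarrow>
   ('m \<Rightarrow> ('m, 'e) tvec \<Rightarrow> real) \<Rightarrow>
   ('m \<Rightarrow> ('m, 'e) tvec \<Rightarrow> ('m, 'e) tvec \<Rightarrow> real) \<Rightarrow> bool" where
  "almost_contact_B_metric A \<phi> \<xi> \<eta> g \<longleftrightarrow>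
     endomorphism_field A \<phi> \<and> smooth_vector_field A (carrier A) \<xi> \<and>
     one_form A \<eta> \<and> pseudo_riemannian_metric A g \<and>
     (\<forall>p\<in>carrier A. \<eta> p (\<xi> p) = 1 \<and>
        (\<forall>u\<in>tangent_space A p. \<phi> p (\<phi> p u) = - u + \<eta> p u *\<^sub>R \<xi> p) \<and>
        (\<forall>u\<in>tangent_space A p. \<forall>v\<in>tangent_space A p.
           g p (\<phi> p u) (\<phi> p v) = - g p u v + \<eta> p u * \<eta> p v))"

definition sasaki_like ::
  "('m::topological_space, 'e::euclidean_space) chart set \<Rightarrow>
   ('m \<Rightarrow> ('m, 'e) tvec \<Rightarrow> ('m, 'e) tvec) \<Rightarrow> ('m \<Rightarrow> ('m, 'e) tvec) \<Rightarrow>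
   ('m \<Rightarrow> ('m, 'e) tvec \<Rightarrow> real) \<Rightarrow>
   ('m \<Rightarrow> ('m, 'e) tvec \<Rightarrow> ('m, 'e) tvec \<Rightarrow> real) \<Rightarrow>
   ('m \<Rightarrow> ('m, 'e) tvec \<Rightarrow> ('m \<Rightarrow> ('m, 'e) tvec) \<Rightarrow> ('m, 'e) tvec) \<Rightarrow> bool" where
  "sasaki_like A \<phi> \<xi> \<eta> g nabla \<longleftrightarrow>
     (\<forall>U X Y. open_in A U \<and> smooth_vector_field A U X \<and> smooth_vector_field A U Y \<longrightarrow>
        (\<forall>p\<in>U. nabla p (X p) (\<lambda>q. \<phi> q (Y q)) - \<phi> p (nabla p (X p) Y) =
           - g p (X p) (Y p) *\<^sub>R \<xi> p - \<eta> p (Y p) *\<^sub>R X p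
           + (2 * \<eta> p (X p) * \<eta> p (Y p)) *\<^sub>R \<xi> p))"


section \<open>Curves\<close>

definition smooth_curve ::
  "('m::topological_space, 'e::euclidean_space) chart set \<Rightarrow> real set \<Rightarrow> (real \<Rightarrow> 'm) \<Rightarrow> bool" where
  "smooth_curve A I C \<longleftrightarrow> is_interval I \<and> interior I \<noteq> {} \<and> C ` I \<subseteq> carrier A \<and>
     continuous_on I C \<and> (\<forall>c\<in>A. smooth_on {t\<in>I. C t \<in> cdom c} (cmap c \<circ> C))"

definition velocity ::
  "('m, 'e::euclidean_space) chart set \<Rightarrow> real set \<Rightarrow> (real \<Rightarrow> 'm) \<Rightarrow> real \<Rightarrow> ('m, 'e) tvec" where
  "velocity A I C t =
     of_components A (C t) (\<lambda>c. vector_derivative (cmap c \<circ> C) (at t within I))"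

definition smooth_field_along ::
  "('m, 'e::euclidean_space) chart set \<Rightarrow> real set \<Rightarrow> (real \<Rightarrow> 'm) \<Rightarrow> (real \<Rightarrow> ('m, 'e) tvec) \<Rightarrow> bool" where
  "smooth_field_along A I C X \<longleftrightarrow> (\<forall>t\<in>I. X t \<in> tangent_space A (C t)) \<and>
     (\<forall>c\<in>A. smooth_on {t\<in>I. C t \<in> cdom c} (\<lambda>t. X t c))"

(* The vector field with constant components u in the chart c; only meaningful on cdom c.  For a
   basis vector u it is the corresponding coordinate vector field. *)
definition coord_field ::
  "('m, 'e::euclidean_space) chart set \<Rightarrow> ('m, 'e) chart \<Rightarrow> 'e \<Rightarrow> 'm \<Rightarrow> ('m, 'e) tvec" where
  "coord_field A c u p = of_components A p (\<lambda>c'. transition_deriv c c' p u)"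

(* The covariant derivative of a vector field X along the curve C, in each chart c given by the
   usual formula: the sum of (dX^k/dt) D_k + X^k nabla_{C'} D_k, with D_k the coordinate fields
   of c.  The second term is combined into the derivative of a single field with constant
   components. *)
definition cov_deriv_along ::
  "('m, 'e::euclidean_space) chart set \<Rightarrow>
   ('m \<Rightarrow> ('m, 'e) tvec \<Rightarrow> ('m \<Rightarrow> ('m, 'e) tvec) \<Rightarrow> ('m, 'e) tvec) \<Rightarrow>
   real set \<Rightarrow> (real \<Rightarrow> 'm) \<Rightarrow> (real \<Rightarrow> ('m, 'e) tvec) \<Rightarrow> real \<Rightarrow> ('m, 'e) tvec" where
  "cov_deriv_along A nabla I C X t = of_components A (C t) (\<lambda>c.
     vector_derivative (\<lambda>s. X s c) (at t within I) +
     nabla (C t) (velocity A I C t) (coord_field A c (X t c)) c)"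

definition null_curve ::
  "('m::topological_space, 'e::euclidean_space) chart set \<Rightarrow>
   ('m \<Rightarrow> ('m, 'e) tvec \<Rightarrow> ('m, 'e) tvec \<Rightarrow> real) \<Rightarrow> real set \<Rightarrow> (real \<Rightarrow> 'm) \<Rightarrow> bool" where
  "null_curve A g I C \<longleftrightarrow> smooth_curve A I C \<and>
     (\<forall>t\<in>I. g (C t) (velocity A I C t) (velocity A I C t) = 0 \<and> velocity A I C t \<noteq> 0)"

definition legendre_curve ::
  "('m::topological_space, 'e::euclidean_space) chart set \<Rightarrow>
   ('m \<Rightarrow> ('m, 'e) tvec \<Rightarrow> real) \<Rightarrow> real set \<Rightarrow> (real \<Rightarrow> 'm) \<Rightarrow> bool" where
  "legendre_curve A \<eta> I C \<longleftrightarrow> smooth_curve A I C \<and> (\<forall>t\<in>I. \<eta> (C t) (velocity A I C t) = 0)"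

definition b_fun ::
  "('m, 'e::euclidean_space) chart set \<Rightarrow>
   ('m \<Rightarrow> ('m, 'e) tvec \<Rightarrow> ('m, 'e) tvec) \<Rightarrow>
   ('m \<Rightarrow> ('m, 'e) tvec \<Rightarrow> ('m, 'e) tvec \<Rightarrow> real) \<Rightarrow> real set \<Rightarrow> (real \<Rightarrow> 'm) \<Rightarrow> real \<Rightarrow> real" where
  "b_fun A \<phi> g I C t = g (C t) (velocity A I C t) (\<phi> (C t) (velocity A I C t))"

(* The first member of the Frenet frame is the velocity of C. *)
definition frenet_frame ::
  "('m::topological_space, 'e::euclidean_space) chart set \<Rightarrow>
   ('m \<Rightarrow> ('m, 'e) tvec \<Rightarrow> ('m, 'e) tvec \<Rightarrow> real) \<Rightarrow> real set \<Rightarrow> (real \<Rightarrow> 'm) \<Rightarrow>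
   (real \<Rightarrow> ('m, 'e) tvec) \<Rightarrow> (real \<Rightarrow> ('m, 'e) tvec) \<Rightarrow> bool" where
  "frenet_frame A g I C N W \<longleftrightarrow> null_curve A g I C \<and>
     smooth_field_along A I C N \<and> smooth_field_along A I C W \<and>
     (\<forall>t\<in>I. g (C t) (velocity A I C t) (N t) = 1 \<and> g (C t) (W t) (W t) = 1 \<and>
        g (C t) (N t) (N t) = 0 \<and> g (C t) (N t) (W t) = 0 \<and>
        g (C t) (velocity A I C t) (W t) = 0)"

definition frenet_equations ::
  "('m, 'e::euclidean_space) chart set \<Rightarrow>
   ('m \<Rightarrow> ('m, 'e) tvec \<Rightarrow> ('m \<Rightarrow> ('m, 'e) tvec) \<Rightarrow> ('m, 'e) tvec) \<Rightarrow>
   real set \<Rightarrow> (real \<Rightarrow> 'm) \<Rightarrow> (real \<Rightarrow> ('m, 'e) tvec) \<Rightarrow> (real \<Rightarrow> ('m, 'e) tvec) \<Rightarrow>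
   (real \<Rightarrow> real) \<Rightarrow> (real \<Rightarrow> real) \<Rightarrow> (real \<Rightarrow> real) \<Rightarrow> bool" where
  "frenet_equations A nabla I C N W h k1 k2 \<longleftrightarrow> (\<forall>t\<in>I.
     cov_deriv_along A nabla I C (velocity A I C) t = h t *\<^sub>R velocity A I C t + k1 t *\<^sub>R W t \<and>
     cov_deriv_along A nabla I C N t = - h t *\<^sub>R N t + k2 t *\<^sub>R W t \<and>
     cov_deriv_along A nabla I C W t = - k2 t *\<^sub>R velocity A I C t - k1 t *\<^sub>R N t)"

(* The function k2 is the Cartan curvature; h = 0 says that the parameter is distinguished. *)
definition null_Cartan_curve where
  "null_Cartan_curve A g nabla I C N W k2 \<longleftrightarrow> frenet_frame A g I C N W \<and>
     frenet_equations A nabla I C N W (\<lambda>t. 0) (\<lambda>t. 1) k2"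

definition null_Cartan_helix where
  "null_Cartan_helix A g nabla I C N W \<kappa> \<longleftrightarrow> null_Cartan_curve A g nabla I C N W (\<lambda>t. \<kappa>)"

definition null_cubic where
  "null_cubic A g nabla I C N W \<longleftrightarrow> null_Cartan_helix A g nabla I C N W 0"

end

theory Submission
  imports Defs
begin

text \<open>
  Write \<open>v\<close> for the velocity, \<open>\<sigma> = \<epsilon>1 * \<epsilon>\<close> and \<open>D\<close> for the covariant derivative along the
  curve.  Since \<open>D \<xi> = - \<phi> v\<close>, differentiating \<open>g(v, \<xi>) = 0\<close> gives \<open>g(D v, \<xi>) = b\<close>.  The scalar
  product of the first Frenet equation with \<open>\<xi>\<close> then reads \<open>b = \<sigma> k1\<close>, that is, \<open>k1 = \<sigma> b\<close>
  (\<open>first_curvature\<close>).  So \<open>k1\<close> is constant exactly if \<open>b\<close> is, and \<open>k1 = 1\<close> exactly if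
  \<open>\<sigma> b = 1\<close>.  The number \<open>b\<close> never vanishes, because in dimension three \<open>v\<close>, \<open>\<phi> v\<close> and \<open>\<xi>\<close> span
  the tangent space and the metric is nondegenerate (\<open>b_nonzero\<close>).

  It remains to see that \<open>h = k2 = 0\<close> whenever \<open>b\<close> is constant (\<open>curvatures_of_constant_b\<close>).
  For constant \<open>b\<close> one has \<open>W = \<sigma> \<xi>\<close>, so that \<open>k2 v + k1 N = \<sigma> \<phi> v\<close> by the third Frenet equation.  The right-hand side is isotropic, and
  the square of the left-hand side is \<open>2 k1 k2\<close>; as \<open>k1\<close> is not zero, \<open>k2\<close> is.  Moreover
  \<open>D (\<phi> v) = \<phi> (D v)\<close> along a Legendre null curve, hence \<open>b' = 2 g(D v, \<phi> v)\<close>, and by the first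
  Frenet equation this equals \<open>2 h b\<close> when \<open>W = \<sigma> \<xi>\<close>.

  The bulk of the work is to justify these differentiations from the connection on vector fields:
  that \<open>D\<close>, given by a coordinate formula in each chart, restricts the connection
  (\<open>cov_deriv_along_field\<close>), is compatible with the metric (\<open>metric_compatible_along\<close>) and obeys
  the Sasaki-like condition (\<open>cov_deriv_along_phi\<close>).  All three come from one Leibniz rule,
  \<open>cov_deriv_along_Leibniz\<close>, for combinations of restrictions of vector fields to the curve.
\<close>

section \<open>Calculus of smooth maps\<close>

lemma Ck_on_cong:
  assumes "Ck_on k S f" and "\<And>x. x \<in> S \<Longrightarrow> f x = g x"
  shows "Ck_on k S g"
  using assms
proof (induction k arbitrary: f g)
  case 0
  then show ?case by (simp cong: continuous_on_cong)
next
  case (Suc k)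
  then obtain f' where f': "\<forall>x\<in>S. (f has_derivative f' x) (at x within S)"
    "\<forall>v. Ck_on k S (\<lambda>x. f' x v)" by auto
  have "(g has_derivative f' x) (at x within S)" if "x \<in> S" for x
    using has_derivative_transform[of x S g f "f' x"] f'(1) Suc.prems(2) that by auto
  with f'(2) show ?case by auto
qed

lemma Ck_on_subset:
  assumes "Ck_on k S f" and "T \<subseteq> S"
  shows "Ck_on k T f"
  using assms
proof (induction k arbitrary: f)
  case 0
  then show ?case by (auto intro: continuous_on_subset)
next
  case (Suc k)
  then obtain f' where f': "\<forall>x\<in>S. (f has_derivative f' x) (at x within S)"
    "\<forall>v. Ck_on k S (\<lambda>x. f' x v)" by auto
  have "(f has_derivative f' x) (at x within T)" if "x \<in> T" for x
    using f'(1) that Suc.prems(2) by (auto intro: has_derivative_subset)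
  moreover have "\<forall>v. Ck_on k T (\<lambda>x. f' x v)" using f'(2) Suc by blast
  ultimately show ?case by auto
qed

lemma Ck_on_decrease: "Ck_on (Suc k) S f \<Longrightarrow> Ck_on k S f"
proof (induction k arbitrary: f)
  case 0
  then show ?case
    by (auto simp: continuous_on_eq_continuous_within intro: has_derivative_continuous)
next
  case (Suc k)
  from Suc.prems obtain f' where f': "\<forall>x\<in>S. (f has_derivative f' x) (at x within S)"
    "\<forall>v. Ck_on (Suc k) S (\<lambda>x. f' x v)" by (subst (asm) Ck_on.simps) blast
  have "\<forall>v. Ck_on k S (\<lambda>x. f' x v)" using f'(2) Suc.IH by blast
  with f'(1) show ?case by auto
qed

lemma Ck_on_const: "Ck_on k S (\<lambda>x. a)"
proof (induction k arbitrary: a)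
  case (Suc k)
  have "\<forall>x\<in>S. ((\<lambda>x. a) has_derivative (\<lambda>v. 0)) (at x within S)" by simp
  with Suc[of 0] show ?case unfolding Ck_on.simps by (intro exI[of _ "\<lambda>x v. 0"]) simp
qed simp

lemma Ck_on_add: "Ck_on k S f \<Longrightarrow> Ck_on k S g \<Longrightarrow> Ck_on k S (\<lambda>x. f x + g x)"
proof (induction k arbitrary: f g)
  case 0
  then show ?case by (auto intro: continuous_on_add)
next
  case (Suc k)
  then obtain f' g' where d: "\<forall>x\<in>S. (f has_derivative f' x) (at x within S)"
    "\<forall>v. Ck_on k S (\<lambda>x. f' x v)" "\<forall>x\<in>S. (g has_derivative g' x) (at x within S)"
    "\<forall>v. Ck_on k S (\<lambda>x. g' x v)" by auto
  show ?case unfolding Ck_on.simps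
    using d Suc.IH by (intro exI[of _ "\<lambda>x v. f' x v + g' x v"]) (auto intro: has_derivative_add)
qed

lemma Ck_on_scaleR:
  "Ck_on k S a \<Longrightarrow> Ck_on k S f \<Longrightarrow> Ck_on k S (\<lambda>x. a x *\<^sub>R f x)"
proof (induction k arbitrary: a f)
  case 0
  then show ?case by (auto intro: continuous_on_scaleR)
next
  case (Suc k)
  then obtain a' f' where d: "\<forall>x\<in>S. (a has_derivative a' x) (at x within S)"
    "\<forall>v. Ck_on k S (\<lambda>x. a' x v)" "\<forall>x\<in>S. (f has_derivative f' x) (at x within S)"
    "\<forall>v. Ck_on k S (\<lambda>x. f' x v)" by auto
  show ?case unfolding Ck_on.simps
    using d Suc.IH Suc.prems[THEN Ck_on_decrease]
    by (intro exI[of _ "\<lambda>x v. a x *\<^sub>R f' x v + a' x v *\<^sub>R f x"])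
      (auto intro!: has_derivative_scaleR Ck_on_add)
qed

lemma Ck_on_sum:
  "finite B \<Longrightarrow> (\<And>i. i \<in> B \<Longrightarrow> Ck_on k S (f i)) \<Longrightarrow> Ck_on k S (\<lambda>x. \<Sum>i\<in>B. f i x)"
  by (induction B rule: finite_induct) (auto intro: Ck_on_const Ck_on_add)

lemma Ck_on_linear:
  assumes L: "bounded_linear L"
  shows "Ck_on k S f \<Longrightarrow> Ck_on k S (\<lambda>x. L (f x))"
proof (induction k arbitrary: f)
  case 0
  then show ?case using bounded_linear.continuous_on[OF L] by auto
next
  case (Suc k)
  then obtain f' where d: "\<forall>x\<in>S. (f has_derivative f' x) (at x within S)"
    "\<forall>v. Ck_on k S (\<lambda>x. f' x v)" by auto
  show ?case unfolding Ck_on.simps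
    using d Suc.IH
    by (intro exI[of _ "\<lambda>x v. L (f' x v)"]) (auto intro: bounded_linear.has_derivative[OF L])
qed

text \<open>By the chain rule the derivative of \<^term>\<open>f \<circ> h\<close> in direction \<^term>\<open>v\<close> is
  \<^term>\<open>f' (h x) (h' x v)\<close>.  Expanding \<^term>\<open>h' x v\<close> in the standard basis turns it into a sum
  of products of maps that the induction hypothesis covers.\<close>

lemma Ck_on_compose:
  fixes h :: "'c::euclidean_space \<Rightarrow> 'a::euclidean_space"
    and f :: "'a \<Rightarrow> 'b::real_normed_vector"
  assumes "Ck_on k S f" and "Ck_on k T h" and "h ` T \<subseteq> S"
  shows "Ck_on k T (\<lambda>x. f (h x))"
  using assms
proof (induction k arbitrary: f)
  case 0
  then show ?case by (auto intro: continuous_on_compose2)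
next
  case (Suc k)
  obtain f' where f': "\<forall>x\<in>S. (f has_derivative f' x) (at x within S)"
    "\<forall>v. Ck_on k S (\<lambda>x. f' x v)" using Suc.prems(1) by auto
  obtain h' where h': "\<forall>x\<in>T. (h has_derivative h' x) (at x within T)"
    "\<forall>v. Ck_on k T (\<lambda>x. h' x v)" using Suc.prems(2) by auto
  have d: "((\<lambda>x. f (h x)) has_derivative (\<lambda>v. f' (h x) (h' x v))) (at x within T)"
    if "x \<in> T" for x
  proof -
    have "(h has_derivative h' x) (at x within T)" using that h'(1) by blast
    moreover have "(f has_derivative f' (h x)) (at (h x) within h ` T)"
      by (rule has_derivative_subset[of f _ _ S]) (use that f'(1) Suc.prems(3) in auto)
    ultimately show ?thesis by (rule has_derivative_in_compose)
  qed
  have k: "Ck_on k T (\<lambda>x. f' (h x) (h' x v))" for v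
  proof -
    have "Ck_on k T (\<lambda>x. f' (h x) i)" for i
      by (rule Suc.IH[OF _ Ck_on_decrease[OF Suc.prems(2)] Suc.prems(3)]) (use f'(2) in simp)
    then have "Ck_on k T (\<lambda>x. \<Sum>i\<in>Basis. (h' x v \<bullet> i) *\<^sub>R f' (h x) i)"
      using h'(2) by (intro Ck_on_sum Ck_on_scaleR Ck_on_linear[OF bounded_linear_inner_left]) auto
    moreover have "(\<Sum>i\<in>Basis. (h' x v \<bullet> i) *\<^sub>R f' (h x) i) = f' (h x) (h' x v)" if "x \<in> T" for x
    proof -
      have "linear (f' (h x))"
        using f'(1) that Suc.prems(3) has_derivative_linear by blast
      then show ?thesis
        using linear_sum[of "f' (h x)" "\<lambda>i. (h' x v \<bullet> i) *\<^sub>R i" Basis]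
        by (simp add: linear_cmul euclidean_representation)
    qed
    ultimately show ?thesis by (rule Ck_on_cong)
  qed
  show ?case unfolding Ck_on.simps
    by (intro exI[of _ "\<lambda>x v. f' (h x) (h' x v)"] conjI ballI allI) (simp_all add: d k)
qed

lemma smooth_onD: "smooth_on S f \<Longrightarrow> Ck_on k S f"
  by (simp add: smooth_on_def)

lemma smooth_onI: "(\<And>k. Ck_on k S f) \<Longrightarrow> smooth_on S f"
  by (simp add: smooth_on_def)

lemma smooth_on_cong:
  "smooth_on S f \<Longrightarrow> (\<And>x. x \<in> S \<Longrightarrow> f x = g x) \<Longrightarrow> smooth_on S g"
  by (rule smooth_onI, rule Ck_on_cong[OF smooth_onD])

lemma smooth_on_subset: "smooth_on S f \<Longrightarrow> T \<subseteq> S \<Longrightarrow> smooth_on T f"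
  by (rule smooth_onI, rule Ck_on_subset[OF smooth_onD])

lemma smooth_on_const: "smooth_on S (\<lambda>x. a)"
  by (rule smooth_onI, rule Ck_on_const)

lemma smooth_on_add: "smooth_on S f \<Longrightarrow> smooth_on S g \<Longrightarrow> smooth_on S (\<lambda>x. f x + g x)"
  by (rule smooth_onI, rule Ck_on_add[OF smooth_onD smooth_onD])

lemma smooth_on_scaleR: "smooth_on S a \<Longrightarrow> smooth_on S f \<Longrightarrow> smooth_on S (\<lambda>x. a x *\<^sub>R f x)"
  by (rule smooth_onI, rule Ck_on_scaleR[OF smooth_onD smooth_onD])

lemma smooth_on_linear: "bounded_linear L \<Longrightarrow> smooth_on S f \<Longrightarrow> smooth_on S (\<lambda>x. L (f x))"
  by (rule smooth_onI, rule Ck_on_linear[OF _ smooth_onD])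

lemma smooth_on_compose:
  "smooth_on S f \<Longrightarrow> smooth_on T h \<Longrightarrow> h ` T \<subseteq> S \<Longrightarrow> smooth_on T (\<lambda>x. f (h x))"
  by (rule smooth_onI, rule Ck_on_compose[OF smooth_onD smooth_onD])

text \<open>Meant for curves: the first derivative is the velocity, which is differentiated once more.\<close>

lemma smooth_on_imp_derivative:
  assumes "smooth_on S f"
  obtains f' where "\<forall>x\<in>S. (f has_derivative f' x) (at x within S)"
    and "\<forall>v. \<forall>x\<in>S. (\<lambda>x. f' x v) differentiable (at x within S)"
proof -
  have "Ck_on (Suc (Suc 0)) S f" using assms by (rule smooth_onD)
  then obtain f' where f': "\<forall>x\<in>S. (f has_derivative f' x) (at x within S)"
    "\<forall>v. Ck_on (Suc 0) S (\<lambda>x. f' x v)" unfolding Ck_on.simps(2)[of "Suc 0"] by blast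
  have "(\<lambda>x. f' x v) differentiable (at x within S)" if "x \<in> S" for v x
  proof -
    from f'(2) have "Ck_on (Suc 0) S (\<lambda>x. f' x v)" by (rule spec)
    then obtain f'' where "\<forall>x\<in>S. ((\<lambda>x. f' x v) has_derivative f'' x) (at x within S)"
      unfolding Ck_on.simps(2) by blast
    with that show ?thesis unfolding differentiable_def by blast
  qed
  with f'(1) show ?thesis using that by blast
qed

lemma smooth_on_open_has_derivative:
  assumes "smooth_on S f" and "open S" and "x \<in> S"
  shows "(f has_derivative frechet_derivative f (at x)) (at x)"
proof -
  obtain f' where "\<forall>x\<in>S. (f has_derivative f' x) (at x within S)"
    using smooth_on_imp_derivative[OF assms(1)] by metis
  from bspec[OF this assms(3)] have "(f has_derivative f' x) (at x)"
    by (simp only: at_within_open[OF assms(3,2)])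
  then show ?thesis using frechet_derivative_at by metis
qed

lemma smooth_on_frechet_derivative:
  assumes "smooth_on S f" and "open S"
  shows "smooth_on S (\<lambda>x. frechet_derivative f (at x) v)"
  unfolding smooth_on_def
proof
  fix k
  have "Ck_on (Suc k) S f" using assms(1) by (rule smooth_onD)
  then obtain f' where f': "\<forall>x\<in>S. (f has_derivative f' x) (at x within S)"
    "\<forall>v. Ck_on k S (\<lambda>x. f' x v)" by auto
  have "f' x = frechet_derivative f (at x)" if "x \<in> S" for x
    using f'(1) that assms(2) frechet_derivative_at by (metis at_within_open)
  then show "Ck_on k S (\<lambda>x. frechet_derivative f (at x) v)"
    using f'(2) by (auto intro: Ck_on_cong[of k S "\<lambda>x. f' x v"])
qed

section \<open>Charts and tangent spaces\<close>

lemma sum_fun_apply: "(\<Sum>i\<in>B. F i) x = (\<Sum>i\<in>B. F i x)"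
  for F :: "'i \<Rightarrow> 'a \<Rightarrow> 'b::comm_monoid_add"
  by (induction B rule: infinite_finite_induct) auto

lemma scaleR_fun_apply [simp]: "(r *\<^sub>R f) x = r *\<^sub>R f x"
  for f :: "'a \<Rightarrow> 'b::real_vector"
  by (simp add: scaleR_fun_def)

lemma
  assumes "lin_on V f" and "subspace V"
  shows lin_on_add: "u \<in> V \<Longrightarrow> w \<in> V \<Longrightarrow> f (u + w) = f u + f w"
    and lin_on_scaleR: "u \<in> V \<Longrightarrow> f (r *\<^sub>R u) = r *\<^sub>R f u"
    and lin_on_0: "f 0 = 0"
    and lin_on_neg: "u \<in> V \<Longrightarrow> f (- u) = - f u"
    and lin_on_diff: "u \<in> V \<Longrightarrow> w \<in> V \<Longrightarrow> f (u - w) = f u - f w"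
proof -
  have *: "f (a *\<^sub>R u + b *\<^sub>R w) = a *\<^sub>R f u + b *\<^sub>R f w" if "u \<in> V" "w \<in> V" for u w a b
    using assms that unfolding lin_on_def by blast
  show "u \<in> V \<Longrightarrow> w \<in> V \<Longrightarrow> f (u + w) = f u + f w" using *[of u w 1 1] by simp
  show s: "u \<in> V \<Longrightarrow> f (r *\<^sub>R u) = r *\<^sub>R f u" for r u using *[of u u r 0] by simp
  show "f 0 = 0" using s[of 0 0] subspace_0[OF assms(2)] by simp
  show "u \<in> V \<Longrightarrow> f (- u) = - f u" using s[of u "-1"] by simp
  show "u \<in> V \<Longrightarrow> w \<in> V \<Longrightarrow> f (u - w) = f u - f w" using *[of u w 1 "-1"] by simp
qed

lemma lin_on_sum:
  assumes "lin_on V f" and "subspace V" and "\<And>i. i \<in> B \<Longrightarrow> u i \<in> V"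
  shows "f (\<Sum>i\<in>B. u i) = (\<Sum>i\<in>B. f (u i))"
  using assms(3)
proof (induction B rule: infinite_finite_induct)
  case (insert i B)
  then show ?case using assms(1,2) by (simp add: lin_on_add subspace_sum)
qed (use assms in \<open>auto simp: lin_on_0\<close>)

lemma is_chart_open_image:
  assumes "is_chart c" and "open U"
  shows "open (cmap c ` (U \<inter> cdom c))"
proof -
  have h: "homeomorphism (cdom c) (cmap c ` cdom c) (cmap c) (cinv c)"
    and o: "open (cmap c ` cdom c)" using assms(1) by (auto simp: is_chart_def)
  have "openin (top_of_set (cdom c)) (U \<inter> cdom c)"
    using openin_open_Int[OF assms(2), of "cdom c"] by (simp only: Int_commute)
  then have "openin (top_of_set (cmap c ` cdom c)) (cmap c ` (U \<inter> cdom c))"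
    by (rule homeomorphism_imp_open_map[OF h])
  then show ?thesis unfolding openin_open_eq[OF o] by (rule conjunct1)
qed

lemma is_chart_cinv:
  assumes "is_chart c" and "p \<in> cdom c"
  shows "cinv c (cmap c p) = p"
  using assms by (auto simp: is_chart_def homeomorphism_def)

locale manifold =
  fixes A :: "('m::{t2_space, second_countable_topology}, 'e::euclidean_space) chart set"
  assumes atlas: "smooth_atlas A"
begin

lemma chart: "c \<in> A \<Longrightarrow> is_chart c"
  using atlas by (auto simp: smooth_atlas_def)

lemma open_cdom: "c \<in> A \<Longrightarrow> open (cdom c)"
  using chart by (auto simp: is_chart_def)

lemma open_in_cdom: "c \<in> A \<Longrightarrow> open_in A (cdom c)"
  using open_cdom by (auto simp: open_in_def carrier_def)

lemma open_in_carrier: "open_in A (carrier A)"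
  using open_cdom by (auto simp: open_in_def carrier_def)

lemma open_in_Int_cdom: "open_in A U \<Longrightarrow> c \<in> A \<Longrightarrow> open_in A (U \<inter> cdom c)"
  using open_cdom[of c] by (auto simp: open_in_def)

lemma charts_atD: "c \<in> charts_at A p \<Longrightarrow> c \<in> A" "c \<in> charts_at A p \<Longrightarrow> p \<in> cdom c"
  by (auto simp: charts_at_def)

lemma ex_chart_at: "p \<in> carrier A \<Longrightarrow> \<exists>c. c \<in> charts_at A p"
  by (auto simp: carrier_def charts_at_def)

lemma transition_smooth:
  "c \<in> A \<Longrightarrow> c' \<in> A \<Longrightarrow> smooth_on (cmap c ` (cdom c \<inter> cdom c')) (cmap c' \<circ> cinv c)"
  using atlas by (auto simp: smooth_atlas_def)

lemma open_overlap: "c \<in> A \<Longrightarrow> c' \<in> A \<Longrightarrow> open (cmap c ` (cdom c \<inter> cdom c'))"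
  using is_chart_open_image[OF chart open_cdom, of c c'] by (simp add: Int_commute)

lemma transition_has_derivative:
  assumes "c \<in> charts_at A p" and "c' \<in> charts_at A p"
  shows "((cmap c' \<circ> cinv c) has_derivative transition_deriv c c' p) (at (cmap c p))"
  unfolding transition_deriv_def
  using assms
  by (intro smooth_on_open_has_derivative[OF transition_smooth open_overlap] imageI IntI)
    (simp_all add: charts_atD)

lemma transition_linear:
  assumes "c \<in> charts_at A p" and "c' \<in> charts_at A p"
  shows "linear (transition_deriv c c' p)"
  using transition_has_derivative[OF assms] has_derivative_linear by blast

lemma transition_cocycle:
  assumes "c \<in> charts_at A p" and "c' \<in> charts_at A p" and "c'' \<in> charts_at A p"
  shows "transition_deriv c' c'' p (transition_deriv c c' p u) = transition_deriv c c'' p u"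
proof -
  have p: "cinv c (cmap c p) = p"
    using assms(1) by (intro is_chart_cinv chart charts_atD)
  have "((\<lambda>x. (cmap c'' \<circ> cinv c') ((cmap c' \<circ> cinv c) x)) has_derivative
      (\<lambda>u. transition_deriv c' c'' p (transition_deriv c c' p u))) (at (cmap c p))"
    by (rule has_derivative_compose[OF transition_has_derivative[OF assms(1,2)]])
      (use transition_has_derivative[OF assms(2,3)] p in \<open>simp add: o_def\<close>)
  then have "((cmap c'' \<circ> cinv c) has_derivative
      (\<lambda>u. transition_deriv c' c'' p (transition_deriv c c' p u))) (at (cmap c p))"
  proof (rule has_derivative_transform_within_open)
    show "open (cmap c ` (cdom c \<inter> cdom c'))" using assms by (intro open_overlap charts_atD)
    show "cmap c p \<in> cmap c ` (cdom c \<inter> cdom c')" using assms by (intro imageI IntI charts_atD)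
    show "(cmap c'' \<circ> cinv c') ((cmap c' \<circ> cinv c) x) = (cmap c'' \<circ> cinv c) x"
      if "x \<in> cmap c ` (cdom c \<inter> cdom c')" for x
      using that assms by (auto simp: charts_at_def is_chart_cinv chart)
  qed
  from has_derivative_unique[OF this transition_has_derivative[OF assms(1,3)]]
  show ?thesis by metis
qed

lemma transition_self:
  assumes "c \<in> charts_at A p"
  shows "transition_deriv c c p u = u"
proof -
  have "((\<lambda>x. x) has_derivative (\<lambda>x. x)) (at (cmap c p))" by simp
  then have "((cmap c \<circ> cinv c) has_derivative (\<lambda>u. u)) (at (cmap c p))"
  proof (rule has_derivative_transform_within_open)
    show "open (cmap c ` (cdom c \<inter> cdom c))" using assms by (intro open_overlap charts_atD)
    show "cmap c p \<in> cmap c ` (cdom c \<inter> cdom c)" using assms by (intro imageI IntI charts_atD)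
    show "x = (cmap c \<circ> cinv c) x" if "x \<in> cmap c ` (cdom c \<inter> cdom c)" for x
      using that assms by (auto simp: charts_at_def is_chart_cinv chart)
  qed
  from has_derivative_unique[OF this transition_has_derivative[OF assms assms]]
  show ?thesis by metis
qed

lemma tangent_spaceI:
  assumes "\<And>c c'. c \<in> charts_at A p \<Longrightarrow> c' \<in> charts_at A p \<Longrightarrow>
      v c' = transition_deriv c c' p (v c)"
    and "\<And>c. c \<notin> charts_at A p \<Longrightarrow> v c = 0"
  shows "v \<in> tangent_space A p"
  unfolding tangent_space_def using assms by blast

lemma tangent_space_transition:
  assumes "v \<in> tangent_space A p" and "c \<in> charts_at A p" and "c' \<in> charts_at A p"
  shows "v c' = transition_deriv c c' p (v c)"
  using assms unfolding tangent_space_def by blast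

lemma tangent_space_outside:
  assumes "v \<in> tangent_space A p" and "c \<notin> charts_at A p"
  shows "v c = 0"
  using assms unfolding tangent_space_def by blast

lemma subspace_tangent_space: "subspace (tangent_space A p)"
proof (rule subspaceI; rule tangent_spaceI)
  fix c c' :: "('m, 'e) chart" assume c: "c \<in> charts_at A p" "c' \<in> charts_at A p"
  note lin = transition_linear[OF c] and tr = tangent_space_transition[OF _ c]
  show "0 c' = transition_deriv c c' p (0 c)" by (simp add: linear_0[OF lin])
  fix u assume u: "u \<in> tangent_space A p"
  show "(r *\<^sub>R u) c' = transition_deriv c c' p ((r *\<^sub>R u) c)" for r
    by (simp only: scaleR_fun_apply linear_cmul[OF lin] tr[OF u])
  fix w assume w: "w \<in> tangent_space A p"
  show "(u + w) c' = transition_deriv c c' p ((u + w) c)"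
    by (simp only: plus_fun_apply linear_add[OF lin] tr[OF u] tr[OF w])
next
  fix c assume c: "c \<notin> charts_at A p"
  show "0 c = 0" by simp
  fix u assume u: "u \<in> tangent_space A p"
  show "(r *\<^sub>R u) c = 0" for r
    by (simp only: scaleR_fun_apply tangent_space_outside[OF u c] scaleR_zero_right)
  fix w assume w: "w \<in> tangent_space A p"
  show "(u + w) c = 0"
    by (simp only: plus_fun_apply tangent_space_outside[OF u c] tangent_space_outside[OF w c]
        add_0)
qed

lemmas tangent_closed =
  subspace_0[OF subspace_tangent_space] subspace_add[OF subspace_tangent_space]
  subspace_scale[OF subspace_tangent_space] subspace_sum[OF subspace_tangent_space]

text \<open>The transition Jacobians carry the components in one chart to every other chart.\<close>

lemma tangent_eqI:
  assumes "u \<in> tangent_space A p" and "w \<in> tangent_space A p"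
    and "c \<in> charts_at A p" and "u c = w c"
  shows "u = w"
proof
  fix c'
  show "u c' = w c'"
  proof (cases "c' \<in> charts_at A p")
    case True
    show ?thesis
      by (simp only: tangent_space_transition[OF assms(1,3) True]
          tangent_space_transition[OF assms(2,3) True] assms(4))
  next
    case False
    show ?thesis
      by (simp only: tangent_space_outside[OF assms(1) False] tangent_space_outside[OF assms(2) False])
  qed
qed

lemma coord_field_component: "c \<in> charts_at A p \<Longrightarrow> coord_field A c u p c = u"
  by (simp only: coord_field_def of_components_def transition_self if_True)

lemma coord_field_tangent:
  assumes "c \<in> charts_at A p"
  shows "coord_field A c u p \<in> tangent_space A p"
  unfolding tangent_space_def mem_Collect_eq
  using assms by (simp add: coord_field_def of_components_def transition_cocycle)

lemma coord_field_of_tangent: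
  assumes "c \<in> charts_at A p" and "u \<in> tangent_space A p"
  shows "coord_field A c (u c) p = u"
  by (rule tangent_eqI[OF coord_field_tangent[OF assms(1)] assms(2,1)
        coord_field_component[OF assms(1)]])

lemma coord_field_expand:
  assumes "c \<in> charts_at A p"
  shows "coord_field A c u p = (\<Sum>i\<in>Basis. (u \<bullet> i) *\<^sub>R coord_field A c i p)"
proof (rule tangent_eqI[OF coord_field_tangent[OF assms] _ assms])
  show "(\<Sum>i\<in>Basis. (u \<bullet> i) *\<^sub>R coord_field A c i p) \<in> tangent_space A p"
    by (intro subspace_sum subspace_scale subspace_tangent_space coord_field_tangent assms)
  show "coord_field A c u p c = (\<Sum>i\<in>Basis. (u \<bullet> i) *\<^sub>R coord_field A c i p) c"
    by (simp add: coord_field_component[OF assms] sum_fun_apply euclidean_representation)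
qed

lemma tangent_expand:
  assumes "c \<in> charts_at A p" and "u \<in> tangent_space A p"
  shows "u = (\<Sum>i\<in>Basis. (u c \<bullet> i) *\<^sub>R coord_field A c i p)"
  using coord_field_expand[OF assms(1), of "u c"] by (simp only: coord_field_of_tangent[OF assms])

subsection \<open>Smooth functions and vector fields\<close>

lemma smooth_function_const: "smooth_function A U (\<lambda>q. a)"
  by (simp add: smooth_function_def comp_def smooth_on_const)

lemma smooth_vector_field_subset:
  "smooth_vector_field A U X \<Longrightarrow> V \<subseteq> U \<Longrightarrow> smooth_vector_field A V X"
  unfolding smooth_vector_field_def by (blast intro: smooth_on_subset)

lemma smooth_vector_field_0: "smooth_vector_field A U (\<lambda>q. 0)"
  by (simp add: smooth_vector_field_def tangent_closed smooth_on_const)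

lemma smooth_vector_field_add:
  "smooth_vector_field A U X \<Longrightarrow> smooth_vector_field A U Y \<Longrightarrow>
    smooth_vector_field A U (\<lambda>q. X q + Y q)"
  by (simp add: smooth_vector_field_def tangent_closed smooth_on_add)

lemma smooth_vector_field_scaleR:
  "smooth_function A U f \<Longrightarrow> smooth_vector_field A U X \<Longrightarrow>
    smooth_vector_field A U (\<lambda>q. f q *\<^sub>R X q)"
  by (simp add: smooth_vector_field_def smooth_function_def comp_def tangent_closed smooth_on_scaleR)

lemma smooth_vector_field_sum:
  "finite B \<Longrightarrow> (\<And>i. i \<in> B \<Longrightarrow> smooth_vector_field A U (X i)) \<Longrightarrow>
    smooth_vector_field A U (\<lambda>q. \<Sum>i\<in>B. X i q)"
  by (induction B rule: finite_induct) (auto intro: smooth_vector_field_0 smooth_vector_field_add)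

lemma smooth_on_change_chart:
  assumes "c \<in> A" and "c' \<in> A" and "smooth_on (cmap c ` (U \<inter> cdom c)) f"
  shows "smooth_on (cmap c' ` (U \<inter> cdom c \<inter> cdom c')) (\<lambda>x. f (cmap c (cinv c' x)))"
proof (rule smooth_on_compose[OF assms(3)])
  have "smooth_on (cmap c' ` (cdom c' \<inter> cdom c)) (\<lambda>x. cmap c (cinv c' x))"
    using transition_smooth[OF assms(2,1)] by (simp add: comp_def)
  then show "smooth_on (cmap c' ` (U \<inter> cdom c \<inter> cdom c')) (\<lambda>x. cmap c (cinv c' x))"
    by (rule smooth_on_subset) auto
qed (use assms in \<open>auto simp: is_chart_cinv chart\<close>)

text \<open>In another chart such a field is the Jacobian of the transition map, evaluated at the
  transformed point and applied to the fixed vector \<^term>\<open>u\<close>.\<close>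

lemma smooth_vector_field_coord_field:
  assumes "c \<in> A"
  shows "smooth_vector_field A (cdom c) (coord_field A c u)"
  unfolding smooth_vector_field_def
proof (intro conjI ballI)
  fix p assume "p \<in> cdom c"
  then show "coord_field A c u p \<in> tangent_space A p"
    using assms by (auto simp: charts_at_def intro: coord_field_tangent)
next
  fix c' assume c': "c' \<in> A"
  have "smooth_on (cmap c ` (cdom c' \<inter> cdom c))
      (\<lambda>y. frechet_derivative (cmap c' \<circ> cinv c) (at y) u)"
    using smooth_on_frechet_derivative[OF transition_smooth open_overlap, of c c'] assms c'
    by (simp add: Int_commute)
  from smooth_on_change_chart[OF assms c' this]
  show "smooth_on (cmap c' ` (cdom c \<inter> cdom c')) (\<lambda>x. coord_field A c u (cinv c' x) c')"
  proof (rule smooth_on_cong[OF smooth_on_subset], goal_cases)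
    case (2 x)
    then obtain q where "x = cmap c' q" "q \<in> cdom c" "q \<in> cdom c'" by auto
    then show ?case
      using assms c'
      by (simp add: is_chart_cinv chart coord_field_def of_components_def transition_deriv_def
          charts_at_def)
  qed auto
qed

lemma smooth_function_component:
  assumes "smooth_vector_field A U Y" and "c \<in> A"
  shows "smooth_function A (U \<inter> cdom c) (\<lambda>q. Y q c \<bullet> i)"
  unfolding smooth_function_def
proof
  fix c' assume c': "c' \<in> A"
  have "smooth_on (cmap c ` (U \<inter> cdom c)) (\<lambda>x. Y (cinv c x) c \<bullet> i)"
    using assms unfolding smooth_vector_field_def
    by (intro smooth_on_linear[OF bounded_linear_inner_left]) auto
  from smooth_on_change_chart[OF assms(2) c' this]
  show "smooth_on (cmap c' ` (U \<inter> cdom c \<inter> cdom c')) ((\<lambda>q. Y q c \<bullet> i) \<circ> cinv c')"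
    by (rule smooth_on_cong) (use assms c' in \<open>auto simp: is_chart_cinv chart\<close>)
qed

end

section \<open>Curves and the covariant derivative along them\<close>

lemma has_vector_derivative_compose_derivative:
  assumes f: "(f has_vector_derivative d) (at t within S)"
    and h: "(h has_derivative h') (at (f t))"
  shows "((\<lambda>s. h (f s)) has_vector_derivative h' d) (at t within S)"
proof -
  have "((\<lambda>s. h (f s)) has_derivative (\<lambda>r. h' (r *\<^sub>R d))) (at t within S)"
    by (rule has_derivative_compose[OF f[unfolded has_vector_derivative_def] h])
  moreover have "h' (r *\<^sub>R d) = r *\<^sub>R h' d" for r
    using has_derivative_linear[OF h] by (rule linear_cmul)
  ultimately show ?thesis unfolding has_vector_derivative_def by simp
qed

locale curve_in_manifold = manifold A
  for A :: "('m::{t2_space, second_countable_topology}, 'e::euclidean_space) chart set" +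
  fixes I :: "real set" and C :: "real \<Rightarrow> 'm"
  assumes curve: "smooth_curve A I C"
begin

abbreviation vel :: "real \<Rightarrow> ('m, 'e) tvec" where "vel \<equiv> velocity A I C"

lemma curve_in_carrier: "t \<in> I \<Longrightarrow> C t \<in> carrier A"
  using curve unfolding smooth_curve_def by blast

lemma within_nontrivial:
  assumes "t \<in> I"
  shows "at t within I \<noteq> bot"
proof -
  have I: "connected I" "interior I \<noteq> {}"
    using curve unfolding smooth_curve_def by (blast intro: is_interval_connected)+
  have "\<nexists>x. I = {x}" using I(2) by auto
  then have "t islimpt I" using connected_imp_perfect[OF I(1) assms] by blast
  then show ?thesis by (simp add: trivial_limit_within)
qed

lemma vector_derivative_unique:
  assumes "t \<in> I" and "(f has_vector_derivative d) (at t within I)"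
    and "(f has_vector_derivative e) (at t within I)"
  shows "d = e"
  using vector_derivative_unique_within[OF within_nontrivial[OF assms(1)] assms(2,3)] .

lemma at_within_preimage:
  assumes "open U" and "t \<in> I" and "C t \<in> U"
  shows "at t within {s \<in> I. C s \<in> U} = at t within I"
proof -
  have "continuous_on I C" using curve unfolding smooth_curve_def by blast
  then obtain V where V: "open V" "V \<inter> I = C -` U \<inter> I"
    using assms(1) unfolding continuous_on_open_invariant by blast
  show ?thesis
    by (rule at_within_nhd[OF _ V(1)]) (use V(2) assms in blast)+
qed

text \<open>The curve stays in an open set for parameters near \<^term>\<open>t\<close>, so derivatives can be computed
  from an expression that is valid in the domain of one chart only.\<close>

lemma has_vector_derivative_local:
  assumes "(f has_vector_derivative d) (at t within I)"
    and "open U" and "t \<in> I" and "C t \<in> U"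
    and eq: "\<And>s. s \<in> I \<Longrightarrow> C s \<in> U \<Longrightarrow> f s = f1 s"
  shows "(f1 has_vector_derivative d) (at t within I)"
proof -
  have "(f has_vector_derivative d) (at t within {s \<in> I. C s \<in> U})"
    using assms(1) by (simp only: at_within_preimage[OF assms(2-4)])
  then have "(f1 has_vector_derivative d) (at t within {s \<in> I. C s \<in> U})"
    by (rule has_vector_derivative_transform[rotated 2]) (use assms(3,4) eq in auto)
  then show ?thesis by (simp only: at_within_preimage[OF assms(2-4)])
qed

text \<open>Reading a smooth curve in a chart gives a map that is twice differentiable; its first
  derivative is the component of the velocity, which is therefore differentiable again.\<close>

lemma
  assumes "t \<in> I" and c: "c \<in> charts_at A (C t)"
  shows curve_has_velocity: "((\<lambda>s. cmap c (C s)) has_vector_derivative vel t c) (at t within I)"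
    and velocity_differentiable: "\<exists>d. ((\<lambda>s. vel s c) has_vector_derivative d) (at t within I)"
proof -
  define J where "J = {s \<in> I. C s \<in> cdom c}"
  have at_J: "at s within J = at s within I" if "s \<in> J" for s
    using at_within_preimage[OF open_cdom[OF charts_atD(1)[OF c]], of s] that unfolding J_def by simp
  have tJ: "t \<in> J" using assms charts_atD(2)[OF c] by (simp add: J_def)
  have "smooth_on J (cmap c \<circ> C)"
    using curve charts_atD(1)[OF c] unfolding smooth_curve_def J_def by blast
  then obtain f' where f': "\<forall>s\<in>J. ((cmap c \<circ> C) has_derivative f' s) (at s within J)"
    and f'': "\<forall>v. \<forall>s\<in>J. (\<lambda>s. f' s v) differentiable (at s within J)"
    by (rule smooth_on_imp_derivative)
  have hvd: "((cmap c \<circ> C) has_vector_derivative f' s 1) (at s within I)" if "s \<in> J" for s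
  proof -
    have d: "((cmap c \<circ> C) has_derivative f' s) (at s within I)"
      using bspec[OF f' that] unfolding at_J[OF that] .
    have eq: "r *\<^sub>R f' s 1 = f' s r" for r
      using linear_cmul[OF has_derivative_linear[OF d], of r 1] by simp
    show ?thesis
      using d by (simp only: has_vector_derivative_def eq)
  qed
  have vel: "vel s c = f' s 1" if "s \<in> J" for s
  proof -
    have "c \<in> charts_at A (C s)" "s \<in> I"
      using that charts_atD(1)[OF c] unfolding J_def charts_at_def by blast+
    then show ?thesis
      using vector_derivative_within[OF within_nontrivial hvd[OF that]]
      by (simp only: velocity_def of_components_def if_True)
  qed
  show "((\<lambda>s. cmap c (C s)) has_vector_derivative vel t c) (at t within I)"
    using hvd[OF tJ] vel[OF tJ] by (simp add: o_def)
  let ?d = "vector_derivative (\<lambda>s. f' s 1) (at t within J)"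
  have "((\<lambda>s. f' s 1) has_vector_derivative ?d) (at t within J)"
    using bspec[OF spec[OF f''] tJ] unfolding vector_derivative_works .
  then have "((\<lambda>s. vel s c) has_vector_derivative ?d) (at t within J)"
    by (rule has_vector_derivative_transform[rotated 2]) (use tJ vel in auto)
  then show "\<exists>d. ((\<lambda>s. vel s c) has_vector_derivative d) (at t within I)"
    unfolding at_J[OF tJ] by (rule exI)
qed

lemma velocity_tangent:
  assumes "t \<in> I"
  shows "vel t \<in> tangent_space A (C t)"
proof (rule tangent_spaceI)
  fix c c' assume c: "c \<in> charts_at A (C t)" and c': "c' \<in> charts_at A (C t)"
  have p: "cinv c (cmap c (C t)) = C t"
    using c by (intro is_chart_cinv chart charts_atD)
  have "((\<lambda>s. (cmap c' \<circ> cinv c) (cmap c (C s))) has_vector_derivative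
      transition_deriv c c' (C t) (vel t c)) (at t within I)"
    by (rule has_vector_derivative_compose_derivative[OF curve_has_velocity[OF assms c]
          transition_has_derivative[OF c c']])
  then have "((\<lambda>s. cmap c' (C s)) has_vector_derivative
      transition_deriv c c' (C t) (vel t c)) (at t within I)"
    by (rule has_vector_derivative_local[where U = "cdom c"])
      (use assms c in \<open>auto simp: charts_at_def is_chart_cinv chart open_cdom\<close>)
  then show "vel t c' = transition_deriv c c' (C t) (vel t c)"
    by (rule vector_derivative_unique[OF assms curve_has_velocity[OF assms c']])
next
  fix c assume "c \<notin> charts_at A (C t)"
  then show "vel t c = 0" by (simp add: velocity_def of_components_def)
qed

text \<open>The directional derivative is evaluated in an arbitrarily chosen chart; the chain rule
  through that chart turns it into the derivative of the function along the curve.\<close>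

lemma has_vector_derivative_along:
  assumes f: "smooth_function A U f" and U: "open_in A U" and t: "t \<in> I" "C t \<in> U"
  shows "((\<lambda>s. f (C s)) has_vector_derivative dir_deriv A (C t) (vel t) f) (at t within I)"
proof -
  define c where "c = (SOME c. c \<in> charts_at A (C t))"
  have c: "c \<in> charts_at A (C t)"
    unfolding c_def using ex_chart_at[OF curve_in_carrier[OF t(1)]] by (rule someI_ex)
  have o: "open U" using U by (simp add: open_in_def)
  have "((f \<circ> cinv c) has_derivative frechet_derivative (f \<circ> cinv c) (at (cmap c (C t))))
      (at (cmap c (C t)))"
  proof (rule smooth_on_open_has_derivative)
    show "smooth_on (cmap c ` (U \<inter> cdom c)) (f \<circ> cinv c)"
      using f charts_atD(1)[OF c] unfolding smooth_function_def by blast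
    show "open (cmap c ` (U \<inter> cdom c))"
      by (rule is_chart_open_image[OF chart[OF charts_atD(1)[OF c]] o])
    show "cmap c (C t) \<in> cmap c ` (U \<inter> cdom c)"
      using t(2) charts_atD(2)[OF c] by blast
  qed
  from has_vector_derivative_compose_derivative[OF curve_has_velocity[OF t(1) c] this]
  have "((\<lambda>s. (f \<circ> cinv c) (cmap c (C s))) has_vector_derivative
      dir_deriv A (C t) (vel t) f) (at t within I)"
    by (simp only: dir_deriv_def Let_def c_def[symmetric])
  then show ?thesis
    by (rule has_vector_derivative_local[where U = "cdom c"])
      (use t c in \<open>auto simp: charts_at_def is_chart_cinv chart open_cdom\<close>)
qed

end

locale curve_with_connection = curve_in_manifold A I C
  for A :: "('m::{t2_space, second_countable_topology}, 'e::euclidean_space) chart set"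
    and I :: "real set" and C :: "real \<Rightarrow> 'm" +
  fixes nabla :: "'m \<Rightarrow> ('m, 'e) tvec \<Rightarrow> ('m \<Rightarrow> ('m, 'e) tvec) \<Rightarrow> ('m, 'e) tvec"
  assumes conn: "affine_connection A nabla"
begin

lemma
  assumes "open_in A U" and "smooth_vector_field A U Y" and "p \<in> U" and "v \<in> tangent_space A p"
  shows nabla_tangent: "nabla p v Y \<in> tangent_space A p"
    and nabla_add: "smooth_vector_field A U Z \<Longrightarrow>
      nabla p v (\<lambda>q. Y q + Z q) = nabla p v Y + nabla p v Z"
    and nabla_scaleR: "smooth_function A U f \<Longrightarrow>
      nabla p v (\<lambda>q. f q *\<^sub>R Y q) = dir_deriv A p v f *\<^sub>R Y p + f p *\<^sub>R nabla p v Y"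
    and nabla_cong: "(\<And>q. q \<in> U \<Longrightarrow> Z q = Y q) \<Longrightarrow> nabla p v Z = nabla p v Y"
proof -
  note H = conn[unfolded affine_connection_def, THEN spec, THEN spec, THEN mp,
      OF conjI[OF assms(1,2)]]
  note H1 = H[THEN conjunct1] and H3 = H[THEN conjunct2, THEN conjunct2]
  show "nabla p v Y \<in> tangent_space A p"
    using H1 assms(3,4) by blast
  show "nabla p v (\<lambda>q. Y q + Z q) = nabla p v Y + nabla p v Z"
    if "smooth_vector_field A U Z"
    using H3[THEN conjunct1] that assms(3,4) by blast
  show "nabla p v (\<lambda>q. f q *\<^sub>R Y q) = dir_deriv A p v f *\<^sub>R Y p + f p *\<^sub>R nabla p v Y"
    if "smooth_function A U f"
    using H3[THEN conjunct2, THEN conjunct1] that assms(3,4) by blast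
  show "nabla p v Z = nabla p v Y" if "\<And>q. q \<in> U \<Longrightarrow> Z q = Y q"
  proof -
    have "\<forall>q\<in>U. Z q = Y q" using that by (rule ballI)
    then show ?thesis
      using H3[THEN conjunct2, THEN conjunct2, THEN spec, THEN mp] assms(3,4) by blast
  qed
qed

lemma nabla_zero:
  assumes "open_in A U" and "p \<in> U" and "v \<in> tangent_space A p"
  shows "nabla p v (\<lambda>q. 0) = 0"
  using nabla_add[OF assms(1) smooth_vector_field_0 assms(2,3) smooth_vector_field_0]
  unfolding add_0_left by (rule add_cancel_right_right[THEN iffD1])

lemma dir_deriv_const: "dir_deriv A p v (\<lambda>q. a) = 0"
  by (simp add: dir_deriv_def Let_def o_def)

lemma nabla_sum:
  assumes "finite B" and U: "open_in A U" "p \<in> U" "v \<in> tangent_space A p"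
    and "\<And>i. i \<in> B \<Longrightarrow> smooth_vector_field A U (Y i)"
    and "\<And>i. i \<in> B \<Longrightarrow> smooth_function A U (f i)"
  shows "nabla p v (\<lambda>q. \<Sum>i\<in>B. f i q *\<^sub>R Y i q) =
    (\<Sum>i\<in>B. dir_deriv A p v (f i) *\<^sub>R Y i p + f i p *\<^sub>R nabla p v (Y i))"
  using assms(1,5,6)
proof (induction B rule: finite_induct)
  case empty
  show ?case using nabla_zero[OF U] by (simp only: sum.empty)
next
  case (insert i B)
  have "nabla p v (\<lambda>q. f i q *\<^sub>R Y i q + (\<Sum>j\<in>B. f j q *\<^sub>R Y j q)) =
      nabla p v (\<lambda>q. f i q *\<^sub>R Y i q) + nabla p v (\<lambda>q. \<Sum>j\<in>B. f j q *\<^sub>R Y j q)"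
    using insert
    by (intro nabla_add[OF U(1) _ U(2,3)] smooth_vector_field_sum smooth_vector_field_scaleR) auto
  moreover have "nabla p v (\<lambda>q. f i q *\<^sub>R Y i q) =
      dir_deriv A p v (f i) *\<^sub>R Y i p + f i p *\<^sub>R nabla p v (Y i)"
    using insert by (intro nabla_scaleR[OF U(1) _ U(2,3)]) auto
  moreover have "nabla p v (\<lambda>q. \<Sum>j\<in>B. f j q *\<^sub>R Y j q) =
      (\<Sum>j\<in>B. dir_deriv A p v (f j) *\<^sub>R Y j p + f j p *\<^sub>R nabla p v (Y j))"
    using insert by blast
  ultimately show ?case by (simp only: sum.insert[OF insert.hyps])
qed

text \<open>Near \<^term>\<open>p\<close> a vector field is the combination of coordinate fields with its components
  as coefficients; locality allows to differentiate this combination instead.\<close>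

lemma nabla_expand:
  assumes U: "open_in A U" "p \<in> U" and Y: "smooth_vector_field A U Y"
    and c: "c \<in> charts_at A p" and v: "v \<in> tangent_space A p"
  shows "nabla p v Y = (\<Sum>i\<in>Basis. dir_deriv A p v (\<lambda>q. Y q c \<bullet> i) *\<^sub>R coord_field A c i p +
    (Y p c \<bullet> i) *\<^sub>R nabla p v (coord_field A c i))"
proof -
  have cA: "c \<in> A" "p \<in> cdom c" using c charts_atD by blast+
  have U': "open_in A (U \<inter> cdom c)" "p \<in> U \<inter> cdom c"
    using open_in_Int_cdom[OF U(1) cA(1)] U(2) cA(2) by blast+
  have "nabla p v (\<lambda>q. \<Sum>i\<in>Basis. (Y q c \<bullet> i) *\<^sub>R coord_field A c i q) = nabla p v Y"
  proof (rule nabla_cong[OF U'(1) smooth_vector_field_subset[OF Y] U'(2) v])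
    fix q assume q: "q \<in> U \<inter> cdom c"
    then have "Y q \<in> tangent_space A q" using Y unfolding smooth_vector_field_def by blast
    moreover have "c \<in> charts_at A q" using q cA(1) by (simp add: charts_at_def)
    ultimately show "(\<Sum>i\<in>Basis. (Y q c \<bullet> i) *\<^sub>R coord_field A c i q) = Y q"
      by (intro tangent_expand[symmetric])
  qed blast
  moreover have "nabla p v (\<lambda>q. \<Sum>i\<in>Basis. (Y q c \<bullet> i) *\<^sub>R coord_field A c i q) =
      (\<Sum>i\<in>Basis. dir_deriv A p v (\<lambda>q. Y q c \<bullet> i) *\<^sub>R coord_field A c i p +
        (Y p c \<bullet> i) *\<^sub>R nabla p v (coord_field A c i))"
    by (rule nabla_sum[OF finite_Basis U' v])
      (rule smooth_vector_field_subset[OF smooth_vector_field_coord_field[OF cA(1)] Int_lower2]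
        smooth_function_component[OF Y cA(1)])+
  ultimately show ?thesis by (simp only:)
qed

lemma nabla_coord_field:
  assumes c: "c \<in> charts_at A p" and v: "v \<in> tangent_space A p"
  shows "nabla p v (coord_field A c u) =
    (\<Sum>i\<in>Basis. (u \<bullet> i) *\<^sub>R nabla p v (coord_field A c i))"
proof -
  have cA: "c \<in> A" "p \<in> cdom c" using c charts_atD by blast+
  note o = open_in_cdom[OF cA(1)] and smooth = smooth_vector_field_coord_field[OF cA(1)]
  have "nabla p v (\<lambda>q. \<Sum>i\<in>Basis. (u \<bullet> i) *\<^sub>R coord_field A c i q) =
      nabla p v (coord_field A c u)"
  proof (rule nabla_cong[OF o smooth cA(2) v])
    fix q assume "q \<in> cdom c"
    then have "c \<in> charts_at A q" using cA(1) by (simp add: charts_at_def)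
    then show "(\<Sum>i\<in>Basis. (u \<bullet> i) *\<^sub>R coord_field A c i q) = coord_field A c u q"
      by (rule coord_field_expand[symmetric])
  qed
  moreover have "nabla p v (\<lambda>q. \<Sum>i\<in>Basis. (u \<bullet> i) *\<^sub>R coord_field A c i q) =
      (\<Sum>i\<in>Basis. dir_deriv A p v (\<lambda>q. u \<bullet> i) *\<^sub>R coord_field A c i p +
        (u \<bullet> i) *\<^sub>R nabla p v (coord_field A c i))"
    by (rule nabla_sum[OF finite_Basis o cA(2) v smooth smooth_function_const])
  ultimately show ?thesis by (simp add: dir_deriv_const)
qed

lemma linear_nabla_coord_field:
  assumes "c \<in> charts_at A p" and "v \<in> tangent_space A p"
  shows "linear (\<lambda>u. nabla p v (coord_field A c u) c)"
proof -
  have "(\<lambda>u. nabla p v (coord_field A c u) c) =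
      (\<lambda>u. \<Sum>i\<in>Basis. (u \<bullet> i) *\<^sub>R nabla p v (coord_field A c i) c)"
    by (subst nabla_coord_field[OF assms]) (simp add: sum_fun_apply)
  then show ?thesis
    by (simp only:) (intro linear_compose_sum ballI linearI; simp add: inner_left_distrib scaleR_add_left)
qed

text \<open>The subtracted term is the Christoffel part of the coordinate formula, so this says that the
  formula, applied to a restricted vector field, returns the connection.\<close>

lemma field_component_along:
  assumes U: "open_in A U" and Y: "smooth_vector_field A U Y" and t: "t \<in> I" "C t \<in> U"
    and c: "c \<in> charts_at A (C t)"
  shows "((\<lambda>s. Y (C s) c) has_vector_derivative
      nabla (C t) (vel t) Y c - nabla (C t) (vel t) (coord_field A c (Y (C t) c)) c)
    (at t within I)"
proof -
  note v = velocity_tangent[OF t(1)]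
  have cA: "c \<in> A" "C t \<in> cdom c" using c charts_atD by blast+
  let ?d = "\<lambda>i. dir_deriv A (C t) (vel t) (\<lambda>q. Y q c \<bullet> i)"
  have "((\<lambda>s. \<Sum>i\<in>Basis. (Y (C s) c \<bullet> i) *\<^sub>R i) has_vector_derivative
      (\<Sum>i\<in>Basis. ?d i *\<^sub>R i)) (at t within I)"
  proof (intro has_vector_derivative_sum)
    fix i :: 'e
    have "((\<lambda>s. Y (C s) c \<bullet> i) has_vector_derivative ?d i) (at t within I)"
      by (rule has_vector_derivative_along[OF smooth_function_component[OF Y cA(1)]
            open_in_Int_cdom[OF U cA(1)] t(1)]) (use t cA in blast)
    from has_vector_derivative_scaleR[OF this[folded has_real_derivative_iff_has_vector_derivative]
        has_vector_derivative_const[of i]]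
    show "((\<lambda>s. (Y (C s) c \<bullet> i) *\<^sub>R i) has_vector_derivative ?d i *\<^sub>R i) (at t within I)"
      by simp
  qed
  moreover have "nabla (C t) (vel t) Y =
      (\<Sum>i\<in>Basis. ?d i *\<^sub>R coord_field A c i (C t)) +
      nabla (C t) (vel t) (coord_field A c (Y (C t) c))"
    unfolding nabla_expand[OF U t(2) Y c v] nabla_coord_field[OF c v, of "Y (C t) c"]
    by (rule sum.distrib)
  then have "nabla (C t) (vel t) Y c - nabla (C t) (vel t) (coord_field A c (Y (C t) c)) c =
      (\<Sum>i\<in>Basis. ?d i *\<^sub>R i)"
    by (simp add: sum_fun_apply coord_field_component[OF c])
  ultimately show ?thesis by (simp add: euclidean_representation)
qed

text \<open>The product rule in an arbitrary chart, together with the linearity of the Christoffel part,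
  gives the components of the right-hand side in that chart.  The right-hand side does not mention
  the chart, so the coordinate formula gives the same vector in all of them.  Every vector field
  along the curve has the form of \<^term>\<open>X\<close> locally, with the coordinate fields of one fixed chart as
  \<^term>\<open>Y\<close>; so the covariant derivative reduces to derivatives of functions and to the connection
  itself.\<close>

lemma cov_deriv_along_Leibniz:
  assumes B: "finite B" and U: "open_in A U" and t: "t \<in> I" "C t \<in> U"
    and Y: "\<And>i. i \<in> B \<Longrightarrow> smooth_vector_field A U (Y i)"
    and f: "\<And>i. i \<in> B \<Longrightarrow> (f i has_vector_derivative f' i) (at t within I)"
    and X: "\<And>s. s \<in> I \<Longrightarrow> C s \<in> U \<Longrightarrow> X s = (\<Sum>i\<in>B. f i s *\<^sub>R Y i (C s))"
  shows "cov_deriv_along A nabla I C X t =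
    (\<Sum>i\<in>B. f' i *\<^sub>R Y i (C t) + f i t *\<^sub>R nabla (C t) (vel t) (Y i))" (is "_ = ?D")
    and "c \<in> charts_at A (C t) \<Longrightarrow> \<exists>d. ((\<lambda>s. X s c) has_vector_derivative d) (at t within I)"
proof -
  note v = velocity_tangent[OF t(1)]
  have o: "open U" using U by (simp add: open_in_def)
  define n where "n = (\<lambda>c u. nabla (C t) (vel t) (coord_field A c u) c)"
  have hvd: "((\<lambda>s. X s c) has_vector_derivative
      (\<Sum>i\<in>B. f i t *\<^sub>R (nabla (C t) (vel t) (Y i) c - n c (Y i (C t) c)) +
        f' i *\<^sub>R Y i (C t) c)) (at t within I)"
    if c: "c \<in> charts_at A (C t)" for c
  proof (rule has_vector_derivative_local[OF _ o t])
    show "((\<lambda>s. \<Sum>i\<in>B. f i s *\<^sub>R Y i (C s) c) has_vector_derivative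
      (\<Sum>i\<in>B. f i t *\<^sub>R (nabla (C t) (vel t) (Y i) c - n c (Y i (C t) c)) +
        f' i *\<^sub>R Y i (C t) c)) (at t within I)"
      unfolding n_def
      by (intro has_vector_derivative_sum has_vector_derivative_scaleR
          field_component_along[OF U Y t c]
          f[folded has_real_derivative_iff_has_vector_derivative])
    show "(\<Sum>i\<in>B. f i s *\<^sub>R Y i (C s) c) = X s c" if "s \<in> I" "C s \<in> U" for s
      using X[OF that] by (simp add: sum_fun_apply)
  qed
  show "\<exists>d. ((\<lambda>s. X s c) has_vector_derivative d) (at t within I)"
    if "c \<in> charts_at A (C t)" using hvd[OF that] by blast
  have D: "?D \<in> tangent_space A (C t)"
    using Y t(2) nabla_tangent[OF U Y t(2) v] unfolding smooth_vector_field_def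
    by (intro tangent_closed) blast+
  show "cov_deriv_along A nabla I C X t = ?D"
  proof
    fix c
    show "cov_deriv_along A nabla I C X t c = ?D c"
    proof (cases "c \<in> charts_at A (C t)")
      case True
      have "linear (n c)" unfolding n_def by (rule linear_nabla_coord_field[OF True v])
      moreover have "X t c = (\<Sum>i\<in>B. f i t *\<^sub>R Y i (C t) c)"
        using X[OF t] by (simp add: sum_fun_apply)
      ultimately have "n c (X t c) = (\<Sum>i\<in>B. f i t *\<^sub>R n c (Y i (C t) c))"
        by (simp add: linear_sum linear_cmul)
      then show ?thesis
        using vector_derivative_within[OF within_nontrivial[OF t(1)] hvd[OF True]] True
        unfolding n_def
        by (simp add: cov_deriv_along_def of_components_def sum_fun_apply
            scaleR_diff_right sum.distrib sum_subtractf)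
    next
      case False
      show ?thesis
        using tangent_space_outside[OF D False] False
        by (simp add: cov_deriv_along_def of_components_def)
    qed
  qed
qed

lemma cov_deriv_along_field:
  assumes "open_in A U" and "smooth_vector_field A U Y" and "t \<in> I" and "C t \<in> U"
  shows "cov_deriv_along A nabla I C (\<lambda>s. Y (C s)) t = nabla (C t) (vel t) Y"
  using cov_deriv_along_Leibniz(1)[of "{()}" U t "\<lambda>_. Y" "\<lambda>_ _. 1" "\<lambda>_. 0" "\<lambda>s. Y (C s)"] assms
  by simp

lemma cov_deriv_along_expand:
  assumes t: "t \<in> I" and c: "c \<in> charts_at A (C t)"
    and X: "\<forall>s\<in>I. X s \<in> tangent_space A (C s)"
    and X': "((\<lambda>s. X s c) has_vector_derivative d) (at t within I)"
  shows "cov_deriv_along A nabla I C X t =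
    (\<Sum>i\<in>Basis. (d \<bullet> i) *\<^sub>R coord_field A c i (C t)) +
    (\<Sum>i\<in>Basis. (X t c \<bullet> i) *\<^sub>R nabla (C t) (vel t) (coord_field A c i))"
proof -
  have cA: "c \<in> A" "C t \<in> cdom c" using c charts_atD by blast+
  have "cov_deriv_along A nabla I C X t = (\<Sum>i\<in>Basis. (d \<bullet> i) *\<^sub>R coord_field A c i (C t) +
    (X t c \<bullet> i) *\<^sub>R nabla (C t) (vel t) (coord_field A c i))"
  proof (rule cov_deriv_along_Leibniz(1)[OF finite_Basis open_in_cdom[OF cA(1)] t cA(2)])
    show "smooth_vector_field A (cdom c) (coord_field A c i)" for i
      by (rule smooth_vector_field_coord_field[OF cA(1)])
    show "((\<lambda>s. X s c \<bullet> i) has_vector_derivative (d \<bullet> i)) (at t within I)" for i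
      using X' by (rule bounded_linear.has_vector_derivative[OF bounded_linear_inner_left])
    fix s assume s: "s \<in> I" "C s \<in> cdom c"
    then have "c \<in> charts_at A (C s)" using cA(1) by (simp add: charts_at_def)
    then show "X s = (\<Sum>i\<in>Basis. (X s c \<bullet> i) *\<^sub>R coord_field A c i (C s))"
      using bspec[OF X s(1)] by (rule tangent_expand)
  qed
  then show ?thesis by (simp only: sum.distrib)
qed

end

section \<open>Metric compatibility along a curve\<close>

lemma lin_on_lincomb:
  assumes "lin_on V f" and "subspace V" and "\<And>i. i \<in> B \<Longrightarrow> u i \<in> V"
  shows "f (\<Sum>i\<in>B. a i *\<^sub>R u i) = (\<Sum>i\<in>B. a i *\<^sub>R f (u i))"
proof -
  have "f (\<Sum>i\<in>B. a i *\<^sub>R u i) = (\<Sum>i\<in>B. f (a i *\<^sub>R u i))"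
    by (rule lin_on_sum[OF assms(1,2)]) (rule subspace_scale[OF assms(2,3)])
  also have "\<dots> = (\<Sum>i\<in>B. a i *\<^sub>R f (u i))"
    by (rule sum.cong[OF refl]) (rule lin_on_scaleR[OF assms(1-3)])
  finally show ?thesis .
qed

locale curve_with_metric = curve_with_connection A I C nabla
  for A :: "('m::{t2_space, second_countable_topology}, 'e::euclidean_space) chart set"
    and I :: "real set" and C :: "real \<Rightarrow> 'm"
    and nabla :: "'m \<Rightarrow> ('m, 'e) tvec \<Rightarrow> ('m \<Rightarrow> ('m, 'e) tvec) \<Rightarrow> ('m, 'e) tvec" +
  fixes g :: "'m \<Rightarrow> ('m, 'e) tvec \<Rightarrow> ('m, 'e) tvec \<Rightarrow> real"
  assumes metric: "pseudo_riemannian_metric A g" and lc: "levi_civita A g nabla"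
begin

lemma
  assumes "p \<in> carrier A" and "u \<in> tangent_space A p"
  shows lin_metric_right: "lin_on (tangent_space A p) (g p u)"
    and metric_sym: "w \<in> tangent_space A p \<Longrightarrow> g p u w = g p w u"
    and metric_nondegenerate: "(\<And>w. w \<in> tangent_space A p \<Longrightarrow> g p u w = 0) \<Longrightarrow> u = 0"
proof -
  note H = bspec[OF metric[unfolded pseudo_riemannian_metric_def, THEN conjunct1] assms(1)]
  show "lin_on (tangent_space A p) (g p u)" by (rule bspec[OF conjunct1[OF H] assms(2)])
  show "g p u w = g p w u" if "w \<in> tangent_space A p"
    by (rule bspec[OF bspec[OF conjunct1[OF conjunct2[OF H]] assms(2)] that])
  show "u = 0" if "\<And>w. w \<in> tangent_space A p \<Longrightarrow> g p u w = 0"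
  proof -
    have "\<forall>w\<in>tangent_space A p. g p u w = 0" using that by (rule ballI)
    with bspec[OF conjunct2[OF conjunct2[OF H]] assms(2)] show ?thesis by (rule mp)
  qed
qed

lemma lin_metric_left:
  assumes p: "p \<in> carrier A" and w: "w \<in> tangent_space A p"
  shows "lin_on (tangent_space A p) (\<lambda>u. g p u w)"
  unfolding lin_on_def
proof (intro ballI allI)
  fix u v a b assume u: "u \<in> tangent_space A p" and v: "v \<in> tangent_space A p"
  have "a *\<^sub>R u + b *\<^sub>R v \<in> tangent_space A p"
    using u v by (intro subspace_add subspace_scale subspace_tangent_space)
  note sym = metric_sym[OF p this w] metric_sym[OF p u w] metric_sym[OF p v w]
  show "g p (a *\<^sub>R u + b *\<^sub>R v) w = a *\<^sub>R g p u w + b *\<^sub>R g p v w"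
    unfolding sym using lin_metric_right[OF p w] u v unfolding lin_on_def by blast
qed

lemma metric_lincomb:
  assumes p: "p \<in> carrier A"
    and u: "\<And>i. i \<in> B \<Longrightarrow> u i \<in> tangent_space A p"
    and w: "\<And>i. i \<in> B \<Longrightarrow> w i \<in> tangent_space A p"
  shows "g p (\<Sum>i\<in>B. x i *\<^sub>R u i) (\<Sum>j\<in>B. y j *\<^sub>R w j) =
    (\<Sum>i\<in>B. \<Sum>j\<in>B. x i * y j * g p (u i) (w j))"
proof -
  let ?y = "\<Sum>j\<in>B. y j *\<^sub>R w j"
  have y: "?y \<in> tangent_space A p"
    using w by (intro subspace_sum subspace_scale subspace_tangent_space)
  have "g p (\<Sum>i\<in>B. x i *\<^sub>R u i) ?y = (\<Sum>i\<in>B. x i *\<^sub>R g p (u i) ?y)"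
    by (rule lin_on_lincomb[OF lin_metric_left[OF p y] subspace_tangent_space u])
  also have "\<dots> = (\<Sum>i\<in>B. x i *\<^sub>R (\<Sum>j\<in>B. y j *\<^sub>R g p (u i) (w j)))"
    by (rule sum.cong[OF refl])
      (simp only: lin_on_lincomb[OF lin_metric_right[OF p u] subspace_tangent_space w])
  finally show ?thesis by (simp add: sum_distrib_left mult.assoc)
qed

lemma smooth_metric:
  assumes "open_in A U" and "smooth_vector_field A U X" and "smooth_vector_field A U Y"
  shows "smooth_function A U (\<lambda>p. g p (X p) (Y p))"
  using metric[unfolded pseudo_riemannian_metric_def, THEN conjunct2, THEN spec, THEN spec,
      THEN spec, THEN mp] assms by blast

lemma dir_deriv_metric:
  assumes "open_in A U" and "smooth_vector_field A U X" and "smooth_vector_field A U Y"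
    and "p \<in> U" and "v \<in> tangent_space A p"
  shows "dir_deriv A p v (\<lambda>q. g q (X q) (Y q)) =
    g p (nabla p v X) (Y p) + g p (X p) (nabla p v Y)"
  using lc[unfolded levi_civita_def, THEN conjunct2, THEN spec, THEN spec, THEN spec, THEN mp,
      OF conjI[OF assms(1) conjI[OF assms(2,3)]], THEN conjunct2] assms(4,5) by blast

lemma cov_deriv_along_tangent:
  assumes t: "t \<in> I" and c: "c \<in> charts_at A (C t)"
    and X: "\<forall>s\<in>I. X s \<in> tangent_space A (C s)"
    and X': "((\<lambda>s. X s c) has_vector_derivative d) (at t within I)"
  shows "cov_deriv_along A nabla I C X t \<in> tangent_space A (C t)"
  unfolding cov_deriv_along_expand[of t c X d, OF assms]
proof (intro subspace_add subspace_sum subspace_scale subspace_tangent_space)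
  show "coord_field A c i (C t) \<in> tangent_space A (C t)" for i by (rule coord_field_tangent[OF c])
  show "nabla (C t) (vel t) (coord_field A c i) \<in> tangent_space A (C t)" for i
    using c charts_atD velocity_tangent[OF t]
    by (intro nabla_tangent[OF open_in_cdom smooth_vector_field_coord_field]) blast+
qed

text \<open>In a chart the scalar product is a combination of the functions
  \<^term>\<open>g q (coord_field A c i q) (coord_field A c j q)\<close>, whose derivatives are known from the
  compatibility of the connection with the metric; the product rule does the rest.\<close>

lemma metric_compatible_along:
  assumes t: "t \<in> I" and c: "c \<in> charts_at A (C t)"
    and X: "\<forall>s\<in>I. X s \<in> tangent_space A (C s)"
    and Y: "\<forall>s\<in>I. Y s \<in> tangent_space A (C s)"
    and X': "((\<lambda>s. X s c) has_vector_derivative x') (at t within I)"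
    and Y': "((\<lambda>s. Y s c) has_vector_derivative y') (at t within I)"
  shows "((\<lambda>s. g (C s) (X s) (Y s)) has_vector_derivative
      g (C t) (cov_deriv_along A nabla I C X t) (Y t) +
      g (C t) (X t) (cov_deriv_along A nabla I C Y t)) (at t within I)"
proof -
  have cA: "c \<in> A" "C t \<in> cdom c" using c charts_atD by blast+
  note o = open_in_cdom[OF cA(1)] and smooth = smooth_vector_field_coord_field[OF cA(1)]
    and v = velocity_tangent[OF t] and p = curve_in_carrier[OF t]
  define E where "E = coord_field A c"
  define D where "D = (\<lambda>i. nabla (C t) (vel t) (E i))"
  define G where "G = g (C t)"
  let ?e = "\<lambda>i. E i (C t)"
  have eT: "?e i \<in> tangent_space A (C t)" for i
    unfolding E_def by (rule coord_field_tangent[OF c])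
  have dT: "D i \<in> tangent_space A (C t)" for i
    unfolding D_def E_def by (rule nabla_tangent[OF o smooth cA(2) v])
  have cov: "cov_deriv_along A nabla I C Z t =
      (\<Sum>i\<in>Basis. (z \<bullet> i) *\<^sub>R ?e i) + (\<Sum>i\<in>Basis. (Z t c \<bullet> i) *\<^sub>R D i)"
    if "\<forall>s\<in>I. Z s \<in> tangent_space A (C s)"
      and "((\<lambda>s. Z s c) has_vector_derivative z) (at t within I)" for Z z
    unfolding E_def D_def by (rule cov_deriv_along_expand[OF t c that])
  have inner': "((\<lambda>s. Z s c \<bullet> i) has_real_derivative z \<bullet> i) (at t within I)"
    if "((\<lambda>s. Z s c) has_vector_derivative z) (at t within I)" for Z z i
    using bounded_linear.has_vector_derivative[OF bounded_linear_inner_left that]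
    unfolding has_real_derivative_iff_has_vector_derivative .
  have gE: "((\<lambda>s. g (C s) (E i (C s)) (E j (C s))) has_real_derivative
      G (D i) (?e j) + G (?e i) (D j)) (at t within I)" for i j
    using has_vector_derivative_along[OF smooth_metric[OF o smooth smooth] o t cA(2), of i j]
    unfolding dir_deriv_metric[OF o smooth smooth cA(2) v]
      has_real_derivative_iff_has_vector_derivative E_def D_def G_def .
  have local: "g (C s) (X s) (Y s) = (\<Sum>i\<in>Basis. \<Sum>j\<in>Basis.
      (X s c \<bullet> i) * (Y s c \<bullet> j) * g (C s) (E i (C s)) (E j (C s)))"
    if s: "s \<in> I" "C s \<in> cdom c" for s
  proof -
    have cs: "c \<in> charts_at A (C s)" using s(2) cA(1) by (simp add: charts_at_def)
    have "g (C s) (\<Sum>i\<in>Basis. (X s c \<bullet> i) *\<^sub>R coord_field A c i (C s))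
        (\<Sum>i\<in>Basis. (Y s c \<bullet> i) *\<^sub>R coord_field A c i (C s)) =
      (\<Sum>i\<in>Basis. \<Sum>j\<in>Basis.
        (X s c \<bullet> i) * (Y s c \<bullet> j) * g (C s) (E i (C s)) (E j (C s)))"
      unfolding E_def
      by (rule metric_lincomb[OF curve_in_carrier[OF s(1)]]) (rule coord_field_tangent[OF cs])+
    then show ?thesis
      by (simp only: tangent_expand[OF cs bspec[OF X s(1)], symmetric]
          tangent_expand[OF cs bspec[OF Y s(1)], symmetric])
  qed
  let ?R = "\<Sum>i\<in>Basis. \<Sum>j\<in>Basis.
      (X t c \<bullet> i) * (Y t c \<bullet> j) * (G (D i) (?e j) + G (?e i) (D j)) +
      ((x' \<bullet> i) * (Y t c \<bullet> j) + (y' \<bullet> j) * (X t c \<bullet> i)) * G (?e i) (?e j)"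
  have "((\<lambda>s. \<Sum>i\<in>Basis. \<Sum>j\<in>Basis.
      (X s c \<bullet> i) * (Y s c \<bullet> j) * g (C s) (E i (C s)) (E j (C s))) has_real_derivative ?R)
    (at t within I)"
    by (intro DERIV_sum DERIV_cong[OF DERIV_mult[OF DERIV_mult[OF inner'[of X, OF X'] inner'[of Y, OF Y']] gE]])
      (simp add: G_def algebra_simps)
  then have "((\<lambda>s. g (C s) (X s) (Y s)) has_vector_derivative ?R) (at t within I)"
    unfolding has_real_derivative_iff_has_vector_derivative
    by (rule has_vector_derivative_local[OF _ open_cdom[OF cA(1)] t cA(2)]) (rule local[symmetric])
  moreover have "?R = G (cov_deriv_along A nabla I C X t) (Y t) +
      G (X t) (cov_deriv_along A nabla I C Y t)"
  proof -
    let ?x = "\<Sum>i\<in>Basis. (X t c \<bullet> i) *\<^sub>R ?e i" and ?y = "\<Sum>i\<in>Basis. (Y t c \<bullet> i) *\<^sub>R ?e i"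
    have T: "(\<Sum>i\<in>Basis. (z \<bullet> i) *\<^sub>R ?e i) \<in> tangent_space A (C t)"
      "(\<Sum>i\<in>Basis. (z \<bullet> i) *\<^sub>R D i) \<in> tangent_space A (C t)" for z
      by (intro subspace_sum subspace_scale subspace_tangent_space eT dT)+
    have xy: "X t = ?x" "Y t = ?y"
      unfolding E_def by (rule tangent_expand[OF c bspec[OF X t]], rule tangent_expand[OF c bspec[OF Y t]])
    have "G (cov_deriv_along A nabla I C X t) (Y t) =
        G (\<Sum>i\<in>Basis. (x' \<bullet> i) *\<^sub>R ?e i) ?y + G (\<Sum>i\<in>Basis. (X t c \<bullet> i) *\<^sub>R D i) ?y"
      unfolding cov[OF X X'] G_def xy(2)[symmetric]
      by (rule lin_on_add[OF lin_metric_left[OF p bspec[OF Y t]] subspace_tangent_space T])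
    moreover have "G (X t) (cov_deriv_along A nabla I C Y t) =
        G ?x (\<Sum>i\<in>Basis. (y' \<bullet> i) *\<^sub>R ?e i) + G ?x (\<Sum>i\<in>Basis. (Y t c \<bullet> i) *\<^sub>R D i)"
      unfolding cov[OF Y Y'] G_def xy(1)[symmetric]
      by (rule lin_on_add[OF lin_metric_right[OF p bspec[OF X t]] subspace_tangent_space T])
    ultimately show ?thesis
      unfolding G_def metric_lincomb[OF p eT eT] metric_lincomb[OF p dT eT] metric_lincomb[OF p eT dT]
      by (simp add: sum.distrib algebra_simps)
  qed
  ultimately show ?thesis unfolding G_def by simp
qed

end

section \<open>Sasaki-like almost contact B-metric manifolds\<close>

locale curve_in_sasaki_like = curve_with_metric A I C nabla g
  for A :: "('m::{t2_space, second_countable_topology}, 'e::euclidean_space) chart set"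
    and I :: "real set" and C :: "real \<Rightarrow> 'm"
    and nabla :: "'m \<Rightarrow> ('m, 'e) tvec \<Rightarrow> ('m \<Rightarrow> ('m, 'e) tvec) \<Rightarrow> ('m, 'e) tvec"
    and g :: "'m \<Rightarrow> ('m, 'e) tvec \<Rightarrow> ('m, 'e) tvec \<Rightarrow> real" +
  fixes \<phi> :: "'m \<Rightarrow> ('m, 'e) tvec \<Rightarrow> ('m, 'e) tvec"
    and \<xi> :: "'m \<Rightarrow> ('m, 'e) tvec"
    and \<eta> :: "'m \<Rightarrow> ('m, 'e) tvec \<Rightarrow> real"
  assumes contact: "almost_contact_B_metric A \<phi> \<xi> \<eta> g"
    and sasaki: "sasaki_like A \<phi> \<xi> \<eta> g nabla"
begin

abbreviation T :: "'m \<Rightarrow> ('m, 'e) tvec set" where "T \<equiv> tangent_space A"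

lemma
  shows endo: "endomorphism_field A \<phi>" and xi_smooth: "smooth_vector_field A (carrier A) \<xi>"
    and one_form: "one_form A \<eta>"
  using contact unfolding almost_contact_B_metric_def by blast+

lemma
  assumes p: "p \<in> carrier A"
  shows xi_tangent: "\<xi> p \<in> T p"
    and lin_phi: "lin_on (T p) (\<phi> p)"
    and phi_tangent: "u \<in> T p \<Longrightarrow> \<phi> p u \<in> T p"
    and lin_eta: "lin_on (T p) (\<eta> p)"
    and eta_xi: "\<eta> p (\<xi> p) = 1"
    and phi_phi: "u \<in> T p \<Longrightarrow> \<phi> p (\<phi> p u) = - u + \<eta> p u *\<^sub>R \<xi> p"
    and metric_phi_phi: "u \<in> T p \<Longrightarrow> w \<in> T p \<Longrightarrow>
      g p (\<phi> p u) (\<phi> p w) = - g p u w + \<eta> p u * \<eta> p w"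
proof -
  have H: "\<eta> p (\<xi> p) = 1 \<and>
        (\<forall>u\<in>T p. \<phi> p (\<phi> p u) = - u + \<eta> p u *\<^sub>R \<xi> p) \<and>
        (\<forall>u\<in>T p. \<forall>v\<in>T p. g p (\<phi> p u) (\<phi> p v) = - g p u v + \<eta> p u * \<eta> p v)"
    using contact p unfolding almost_contact_B_metric_def by blast
  show "\<xi> p \<in> T p" using xi_smooth p unfolding smooth_vector_field_def by blast
  show "lin_on (T p) (\<phi> p)" "u \<in> T p \<Longrightarrow> \<phi> p u \<in> T p"
    using endo p unfolding endomorphism_field_def by blast+
  show "lin_on (T p) (\<eta> p)" using one_form p unfolding one_form_def by blast
  show "\<eta> p (\<xi> p) = 1" using H by blast
  show "u \<in> T p \<Longrightarrow> \<phi> p (\<phi> p u) = - u + \<eta> p u *\<^sub>R \<xi> p" using H by blast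
  show "u \<in> T p \<Longrightarrow> w \<in> T p \<Longrightarrow> g p (\<phi> p u) (\<phi> p w) = - g p u w + \<eta> p u * \<eta> p w"
    using H by blast
qed

lemma xi_nonzero:
  assumes "p \<in> carrier A"
  shows "\<xi> p \<noteq> 0"
  using eta_xi[OF assms] lin_on_0[OF lin_eta[OF assms] subspace_tangent_space] by force

text \<open>Applying \<^term>\<open>\<phi> p\<close> to the formula for its square in two ways gives
  \<^term>\<open>\<eta> p (\<phi> p u) *\<^sub>R \<xi> p = \<eta> p u *\<^sub>R \<phi> p (\<xi> p)\<close>.
  For \<^term>\<open>u = \<xi> p\<close> this makes \<^term>\<open>\<phi> p (\<xi> p)\<close> a multiple of \<^term>\<open>\<xi> p\<close>; as its
  image under \<^term>\<open>\<phi> p\<close> vanishes, so does the multiple.\<close>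

lemma phi_xi:
  assumes p: "p \<in> carrier A"
  shows "\<phi> p (\<xi> p) = 0"
proof -
  note x = xi_tangent[OF p] and fx = phi_tangent[OF p xi_tangent[OF p]]
    and lin = lin_phi[OF p] subspace_tangent_space
  define r where "r = \<eta> p (\<phi> p (\<xi> p))"
  have ff: "\<phi> p (\<phi> p (\<xi> p)) = 0" using phi_phi[OF p x] eta_xi[OF p] by simp
  have "\<phi> p (\<phi> p (\<phi> p (\<xi> p))) = 0" unfolding ff by (rule lin_on_0[OF lin])
  then have "- \<phi> p (\<xi> p) + r *\<^sub>R \<xi> p = 0" unfolding phi_phi[OF p fx] r_def .
  then have r: "\<phi> p (\<xi> p) = r *\<^sub>R \<xi> p" by (metis neg_eq_iff_add_eq_0 minus_minus)
  have "\<phi> p (r *\<^sub>R \<xi> p) = r *\<^sub>R \<phi> p (\<xi> p)" by (rule lin_on_scaleR[OF lin x])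
  then have "0 = r *\<^sub>R (r *\<^sub>R \<xi> p)" using ff unfolding r by metis
  then have "r = 0" using xi_nonzero[OF p] by (metis scaleR_eq_0_iff)
  then show ?thesis using r by (metis scaleR_zero_left)
qed

lemma eta_phi:
  assumes p: "p \<in> carrier A" and u: "u \<in> T p"
  shows "\<eta> p (\<phi> p u) = 0"
proof -
  note x = xi_tangent[OF p] and fu = phi_tangent[OF p u]
    and lin = lin_phi[OF p] subspace_tangent_space
  have "\<phi> p (\<phi> p (\<phi> p u)) = \<phi> p (- u + \<eta> p u *\<^sub>R \<xi> p)"
    unfolding phi_phi[OF p u] ..
  also have "\<dots> = - \<phi> p u + \<eta> p u *\<^sub>R \<phi> p (\<xi> p)"
    using lin_on_add[OF lin subspace_neg[OF lin(2) u] subspace_scale[OF lin(2) x]]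
      lin_on_neg[OF lin u] lin_on_scaleR[OF lin x] by metis
  finally have "- \<phi> p u + \<eta> p (\<phi> p u) *\<^sub>R \<xi> p = - \<phi> p u"
    unfolding phi_phi[OF p fu] phi_xi[OF p] by (simp only: scaleR_zero_right add_0_right)
  then have "\<eta> p (\<phi> p u) *\<^sub>R \<xi> p = 0" by (metis add_cancel_left_right)
  then show ?thesis using xi_nonzero[OF p] by (metis scaleR_eq_0_iff)
qed

lemma metric_xi:
  assumes p: "p \<in> carrier A" and u: "u \<in> T p"
  shows "g p u (\<xi> p) = \<eta> p u"
  using metric_phi_phi[OF p u xi_tangent[OF p]] eta_xi[OF p]
    lin_on_0[OF lin_metric_right[OF p phi_tangent[OF p u]] subspace_tangent_space]
  unfolding phi_xi[OF p] by simp

text \<open>Replace both arguments by their images under \<^term>\<open>\<phi>\<close>: on the image of \<^term>\<open>\<phi>\<close>, where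
  \<^term>\<open>\<eta>\<close> vanishes, \<^term>\<open>\<phi>\<close> reverses the sign of the metric and squares to minus one.\<close>

lemma metric_phi_sym:
  assumes p: "p \<in> carrier A" and u: "u \<in> T p" and w: "w \<in> T p"
  shows "g p (\<phi> p u) w = g p u (\<phi> p w)"
proof -
  note fu = phi_tangent[OF p u] and fw = phi_tangent[OF p w] and x = xi_tangent[OF p]
    and lin = lin_metric_left[OF p phi_tangent[OF p w]] subspace_tangent_space
  have "- g p (\<phi> p u) w = g p (\<phi> p (\<phi> p u)) (\<phi> p w)"
    using metric_phi_phi[OF p fu w] eta_phi[OF p u] by simp
  also have "\<dots> = - g p u (\<phi> p w) + \<eta> p u * g p (\<xi> p) (\<phi> p w)"
    unfolding phi_phi[OF p u]
    using lin_on_add[OF lin subspace_neg[OF lin(2) u] subspace_scale[OF lin(2) x]]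
      lin_on_neg[OF lin u] lin_on_scaleR[OF lin x] by simp
  also have "g p (\<xi> p) (\<phi> p w) = 0"
    using metric_sym[OF p x fw] metric_xi[OF p fw] eta_phi[OF p w] by simp
  finally show ?thesis by simp
qed

lemma smooth_phi:
  "open_in A U \<Longrightarrow> smooth_vector_field A U Y \<Longrightarrow> smooth_vector_field A U (\<lambda>q. \<phi> q (Y q))"
  using endo unfolding endomorphism_field_def by blast

lemma nabla_phi:
  assumes U: "open_in A U" and Y: "smooth_vector_field A U Y" and p: "p \<in> U" and v: "v \<in> T p"
  shows "nabla p v (\<lambda>q. \<phi> q (Y q)) = \<phi> p (nabla p v Y) +
    (- g p v (Y p) *\<^sub>R \<xi> p - \<eta> p (Y p) *\<^sub>R v + (2 * \<eta> p v * \<eta> p (Y p)) *\<^sub>R \<xi> p)"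
proof -
  obtain c where c: "c \<in> charts_at A p"
    using U p ex_chart_at unfolding open_in_def by blast
  have cA: "c \<in> A" "p \<in> cdom c" using c charts_atD by blast+
  have U': "open_in A (U \<inter> cdom c)" "p \<in> U \<inter> cdom c"
    using open_in_Int_cdom[OF U cA(1)] p cA(2) by blast+
  have X: "smooth_vector_field A (U \<inter> cdom c) (coord_field A c (v c))"
    by (rule smooth_vector_field_subset[OF smooth_vector_field_coord_field[OF cA(1)]]) blast
  have Y': "smooth_vector_field A (U \<inter> cdom c) Y"
    by (rule smooth_vector_field_subset[OF Y]) blast
  have Xp: "coord_field A c (v c) p = v" by (rule coord_field_of_tangent[OF c v])
  have "nabla p v (\<lambda>q. \<phi> q (Y q)) - \<phi> p (nabla p v Y) =
      - g p v (Y p) *\<^sub>R \<xi> p - \<eta> p (Y p) *\<^sub>R v + (2 * \<eta> p v * \<eta> p (Y p)) *\<^sub>R \<xi> p"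
    using bspec[OF sasaki[unfolded sasaki_like_def, THEN spec, THEN spec, THEN spec, THEN mp,
        OF conjI[OF U'(1) conjI[OF X Y']]] U'(2)]
    unfolding Xp .
  then show ?thesis by (metis diff_add_cancel add.commute)
qed

text \<open>The right-hand side of the Sasaki-like condition is linear in the differentiated vector,
  so the condition passes from coordinate fields to fields along the curve.\<close>

lemma cov_deriv_along_phi:
  assumes t: "t \<in> I" and c: "c \<in> charts_at A (C t)"
    and X: "\<forall>s\<in>I. X s \<in> T (C s)"
    and X': "((\<lambda>s. X s c) has_vector_derivative d) (at t within I)"
  shows "cov_deriv_along A nabla I C (\<lambda>s. \<phi> (C s) (X s)) t =
      \<phi> (C t) (cov_deriv_along A nabla I C X t) +
      (- g (C t) (vel t) (X t) *\<^sub>R \<xi> (C t) - \<eta> (C t) (X t) *\<^sub>R vel t +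
        (2 * \<eta> (C t) (vel t) * \<eta> (C t) (X t)) *\<^sub>R \<xi> (C t))"
    and "\<exists>e. ((\<lambda>s. \<phi> (C s) (X s) c) has_vector_derivative e) (at t within I)"
proof -
  have cA: "c \<in> A" "C t \<in> cdom c" using c charts_atD by blast+
  note o = open_in_cdom[OF cA(1)] and smooth = smooth_vector_field_coord_field[OF cA(1)]
    and v = velocity_tangent[OF t] and p = curve_in_carrier[OF t]
  define S where "S = (\<lambda>w. - g (C t) (vel t) w *\<^sub>R \<xi> (C t) - \<eta> (C t) w *\<^sub>R vel t +
        (2 * \<eta> (C t) (vel t) * \<eta> (C t) w) *\<^sub>R \<xi> (C t))"
  have linS: "lin_on (T (C t)) S"
  proof -
    \<comment> \<open>stated for an abstract vector space, so that tangent vectors are not unfolded into functions\<close>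
    have vec: "- (a * x + b * x') *\<^sub>R k - (a * y + b * y') *\<^sub>R v + (r * (a * y + b * y')) *\<^sub>R k =
      a *\<^sub>R (- x *\<^sub>R k - y *\<^sub>R v + (r * y) *\<^sub>R k) + b *\<^sub>R (- x' *\<^sub>R k - y' *\<^sub>R v + (r * y') *\<^sub>R k)"
      for a b r x x' y y' and k v :: "'z::real_vector" by (simp add: algebra_simps)
    show ?thesis
      unfolding lin_on_def
    proof (intro ballI allI)
      fix u w a b assume u: "u \<in> T (C t)" and w: "w \<in> T (C t)"
      have g_eta: "g (C t) (vel t) (a *\<^sub>R u + b *\<^sub>R w) =
          a * g (C t) (vel t) u + b * g (C t) (vel t) w"
        "\<eta> (C t) (a *\<^sub>R u + b *\<^sub>R w) = a * \<eta> (C t) u + b * \<eta> (C t) w"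
        using lin_metric_right[OF p v] lin_eta[OF p] u w unfolding lin_on_def real_scaleR_def
        by blast+
      show "S (a *\<^sub>R u + b *\<^sub>R w) = a *\<^sub>R S u + b *\<^sub>R S w"
        unfolding S_def g_eta by (rule vec)
    qed
  qed
  let ?E = "\<lambda>i. coord_field A c i" and ?D = "\<lambda>i. nabla (C t) (vel t) (coord_field A c i)"
  have local: "\<phi> (C s) (X s) = (\<Sum>i\<in>Basis. (X s c \<bullet> i) *\<^sub>R \<phi> (C s) (?E i (C s)))"
    if s: "s \<in> I" "C s \<in> cdom c" for s
  proof -
    have cs: "c \<in> charts_at A (C s)" using s(2) cA(1) by (simp add: charts_at_def)
    show ?thesis
      using lin_on_lincomb[of "T (C s)" "\<phi> (C s)" Basis "\<lambda>i. coord_field A c i (C s)"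
          "\<lambda>i. X s c \<bullet> i", OF lin_phi[OF curve_in_carrier[OF s(1)]] subspace_tangent_space
          coord_field_tangent[OF cs]]
      by (simp only: tangent_expand[OF cs bspec[OF X s(1)], symmetric])
  qed
  have X'': "((\<lambda>s. X s c \<bullet> i) has_vector_derivative (d \<bullet> i)) (at t within I)" for i
    using X' by (rule bounded_linear.has_vector_derivative[OF bounded_linear_inner_left])
  note Leibniz = cov_deriv_along_Leibniz[OF finite_Basis o t cA(2) smooth_phi[OF o smooth] X'']
  show "\<exists>e. ((\<lambda>s. \<phi> (C s) (X s) c) has_vector_derivative e) (at t within I)"
    by (rule Leibniz(2)[OF local c])
  have eT: "?E i (C t) \<in> T (C t)" for i by (rule coord_field_tangent[OF c])
  have dT: "?D i \<in> T (C t)" for i by (rule nabla_tangent[OF o smooth cA(2) v])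
  have "cov_deriv_along A nabla I C (\<lambda>s. \<phi> (C s) (X s)) t =
      (\<Sum>i\<in>Basis. (d \<bullet> i) *\<^sub>R \<phi> (C t) (?E i (C t)) +
        (X t c \<bullet> i) *\<^sub>R (\<phi> (C t) (?D i) + S (?E i (C t))))"
    unfolding S_def nabla_phi[OF o smooth cA(2) v, symmetric] by (rule Leibniz(1)[OF local])
  also have "\<dots> = (\<Sum>i\<in>Basis. (d \<bullet> i) *\<^sub>R \<phi> (C t) (?E i (C t))) +
      (\<Sum>i\<in>Basis. (X t c \<bullet> i) *\<^sub>R \<phi> (C t) (?D i)) + (\<Sum>i\<in>Basis. (X t c \<bullet> i) *\<^sub>R S (?E i (C t)))"
    by (simp only: sum.distrib scaleR_add_right add.assoc)
  also have "\<dots> = \<phi> (C t) (\<Sum>i\<in>Basis. (d \<bullet> i) *\<^sub>R ?E i (C t)) +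
      \<phi> (C t) (\<Sum>i\<in>Basis. (X t c \<bullet> i) *\<^sub>R ?D i) + S (\<Sum>i\<in>Basis. (X t c \<bullet> i) *\<^sub>R ?E i (C t))"
    by (simp only: lin_on_lincomb[OF lin_phi[OF p] subspace_tangent_space eT]
        lin_on_lincomb[OF lin_phi[OF p] subspace_tangent_space dT]
        lin_on_lincomb[OF linS subspace_tangent_space eT])
  also have "\<phi> (C t) (\<Sum>i\<in>Basis. (d \<bullet> i) *\<^sub>R ?E i (C t)) +
      \<phi> (C t) (\<Sum>i\<in>Basis. (X t c \<bullet> i) *\<^sub>R ?D i) =
      \<phi> (C t) (cov_deriv_along A nabla I C X t)"
    unfolding cov_deriv_along_expand[of t c X, OF t c X X']
    by (rule lin_on_add[OF lin_phi[OF p] subspace_tangent_space, symmetric];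
        intro subspace_sum subspace_scale subspace_tangent_space eT dT)
  also have "(\<Sum>i\<in>Basis. (X t c \<bullet> i) *\<^sub>R ?E i (C t)) = X t"
    by (rule tangent_expand[OF c bspec[OF X t], symmetric])
  finally show "cov_deriv_along A nabla I C (\<lambda>s. \<phi> (C s) (X s)) t =
      \<phi> (C t) (cov_deriv_along A nabla I C X t) +
      (- g (C t) (vel t) (X t) *\<^sub>R \<xi> (C t) - \<eta> (C t) (X t) *\<^sub>R vel t +
        (2 * \<eta> (C t) (vel t) * \<eta> (C t) (X t)) *\<^sub>R \<xi> (C t))"
    unfolding S_def .
qed

text \<open>The Sasaki-like condition for \<^term>\<open>\<xi>\<close> itself, where \<^term>\<open>\<phi> p (\<xi> p) = 0\<close>, determines
  the image of the derivative of \<^term>\<open>\<xi>\<close> under \<^term>\<open>\<phi>\<close>, hence the derivative up to a multiple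
  of \<^term>\<open>\<xi>\<close>.  The multiple vanishes because \<^term>\<open>\<xi>\<close> has constant length.\<close>

lemma cov_deriv_along_xi:
  assumes t: "t \<in> I"
  shows "cov_deriv_along A nabla I C (\<lambda>s. \<xi> (C s)) t = - \<phi> (C t) (vel t)"
proof -
  note v = velocity_tangent[OF t] and p = curve_in_carrier[OF t] and o = open_in_carrier
    and x = xi_tangent[OF curve_in_carrier[OF t]]
    and lin = lin_phi[OF curve_in_carrier[OF t]] subspace_tangent_space
  define D where "D = nabla (C t) (vel t) \<xi>"
  have DT: "D \<in> T (C t)" unfolding D_def by (rule nabla_tangent[OF o xi_smooth p v])
  have "((\<lambda>s. g (C s) (\<xi> (C s)) (\<xi> (C s))) has_vector_derivative
      g (C t) D (\<xi> (C t)) + g (C t) (\<xi> (C t)) D) (at t within I)"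
    using has_vector_derivative_along[OF smooth_metric[OF o xi_smooth xi_smooth] o t p]
    unfolding dir_deriv_metric[OF o xi_smooth xi_smooth p v] D_def .
  then have "((\<lambda>s. 1) has_vector_derivative
      g (C t) D (\<xi> (C t)) + g (C t) (\<xi> (C t)) D) (at t within I)"
    by (rule has_vector_derivative_transform[OF t, rotated])
      (use curve_in_carrier in \<open>simp add: metric_xi xi_tangent eta_xi\<close>)
  from vector_derivative_unique[OF t this has_vector_derivative_const]
  have etaD: "\<eta> (C t) D = 0"
    using metric_sym[OF p x DT] metric_xi[OF p DT] by simp
  have "nabla (C t) (vel t) (\<lambda>q. \<phi> q (\<xi> q)) = nabla (C t) (vel t) (\<lambda>q. 0)"
    by (rule nabla_cong[OF o smooth_vector_field_0 p v]) (rule phi_xi)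
  then have zero: "nabla (C t) (vel t) (\<lambda>q. \<phi> q (\<xi> q)) = 0"
    unfolding nabla_zero[OF o p v] .
  \<comment> \<open>again in an abstract vector space\<close>
  have vec: "y = v - e *\<^sub>R k" if "0 = y + (- e *\<^sub>R k - 1 *\<^sub>R v + (2 * e * 1) *\<^sub>R k)"
    for e and y k v :: "'z::real_vector"
    using that by (simp add: algebra_simps scaleR_2 flip: scaleR_scaleR)
  have fD: "\<phi> (C t) D = vel t - \<eta> (C t) (vel t) *\<^sub>R \<xi> (C t)"
    using nabla_phi[OF o xi_smooth p v] unfolding zero eta_xi[OF p] metric_xi[OF p v] D_def
    by (rule vec)
  have "- D + \<eta> (C t) D *\<^sub>R \<xi> (C t) = \<phi> (C t) (vel t - \<eta> (C t) (vel t) *\<^sub>R \<xi> (C t))"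
    unfolding phi_phi[OF p DT, symmetric] fD ..
  also have "\<dots> = \<phi> (C t) (vel t) - \<eta> (C t) (vel t) *\<^sub>R \<phi> (C t) (\<xi> (C t))"
    using lin_on_diff[OF lin v subspace_scale[OF lin(2) x]] lin_on_scaleR[OF lin x] by metis
  finally have "- D = \<phi> (C t) (vel t)"
    unfolding etaD phi_xi[OF p]
    by (simp only: scaleR_zero_left scaleR_zero_right diff_zero add_0_right)
  moreover have "cov_deriv_along A nabla I C (\<lambda>s. \<xi> (C s)) t = D"
    unfolding D_def by (rule cov_deriv_along_field[OF o xi_smooth t p])
  ultimately show ?thesis by (metis minus_minus)
qed

end

section \<open>Legendre null curves\<close>

locale legendre_null_curve = curve_in_sasaki_like A I C nabla g \<phi> \<xi> \<eta>
  for A :: "('m::{t2_space, second_countable_topology}, real^3) chart set"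
    and I :: "real set" and C :: "real \<Rightarrow> 'm"
    and nabla :: "'m \<Rightarrow> ('m, real^3) tvec \<Rightarrow> ('m \<Rightarrow> ('m, real^3) tvec) \<Rightarrow> ('m, real^3) tvec"
    and g :: "'m \<Rightarrow> ('m, real^3) tvec \<Rightarrow> ('m, real^3) tvec \<Rightarrow> real"
    and \<phi> :: "'m \<Rightarrow> ('m, real^3) tvec \<Rightarrow> ('m, real^3) tvec"
    and \<xi> :: "'m \<Rightarrow> ('m, real^3) tvec"
    and \<eta> :: "'m \<Rightarrow> ('m, real^3) tvec \<Rightarrow> real" +
  assumes null: "null_curve A g I C" and legendre: "legendre_curve A \<eta> I C"
begin

abbreviation b :: "real \<Rightarrow> real" where "b \<equiv> b_fun A \<phi> g I C"

abbreviation cov :: "(real \<Rightarrow> ('m, real^3) tvec) \<Rightarrow> real \<Rightarrow> ('m, real^3) tvec"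
  where "cov \<equiv> cov_deriv_along A nabla I C"

lemma
  assumes "t \<in> I"
  shows metric_vel_vel: "g (C t) (vel t) (vel t) = 0" and vel_nonzero: "vel t \<noteq> 0"
    and eta_vel: "\<eta> (C t) (vel t) = 0"
  using null legendre assms unfolding null_curve_def legendre_curve_def by blast+

lemma
  assumes p: "p \<in> carrier A" and u: "u \<in> T p" and v: "v \<in> T p" and w: "w \<in> T p"
  shows metric_left: "g p (x *\<^sub>R u + y *\<^sub>R v) w = x * g p u w + y * g p v w"
    and metric_right: "g p w (x *\<^sub>R u + y *\<^sub>R v) = x * g p w u + y * g p w v"
  using lin_metric_left[OF p w] lin_metric_right[OF p w] u v
  unfolding lin_on_def real_scaleR_def by blast+

lemma metric_phi_vel:
  assumes t: "t \<in> I"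
  shows "g (C t) (vel t) (\<phi> (C t) (vel t)) = b t" "g (C t) (\<phi> (C t) (vel t)) (vel t) = b t"
    "g (C t) (\<phi> (C t) (vel t)) (\<phi> (C t) (vel t)) = 0"
    "g (C t) (\<xi> (C t)) (\<phi> (C t) (vel t)) = 0"
    "g (C t) (vel t) (\<xi> (C t)) = 0" "g (C t) (\<xi> (C t)) (\<xi> (C t)) = 1"
proof -
  note p = curve_in_carrier[OF t] and v = velocity_tangent[OF t]
  note x = xi_tangent[OF p] and fv = phi_tangent[OF p v]
  show "g (C t) (vel t) (\<phi> (C t) (vel t)) = b t" by (simp only: b_fun_def)
  then show "g (C t) (\<phi> (C t) (vel t)) (vel t) = b t" by (simp only: metric_phi_sym[OF p v v])
  show "g (C t) (\<phi> (C t) (vel t)) (\<phi> (C t) (vel t)) = 0"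
    by (simp add: metric_phi_phi[OF p v v] metric_vel_vel[OF t] eta_vel[OF t])
  show "g (C t) (\<xi> (C t)) (\<phi> (C t) (vel t)) = 0"
    by (simp only: metric_sym[OF p x fv] metric_xi[OF p fv] eta_phi[OF p v])
  show "g (C t) (vel t) (\<xi> (C t)) = 0" by (simp only: metric_xi[OF p v] eta_vel[OF t])
  show "g (C t) (\<xi> (C t)) (\<xi> (C t)) = 1" by (simp only: metric_xi[OF p x] eta_xi[OF p])
qed

text \<open>This is where dimension three enters: the velocity, its image under \<^term>\<open>\<phi>\<close> and
  \<^term>\<open>\<xi>\<close> are linearly independent, so they span the tangent space.  If \<^term>\<open>b t\<close> were zero,
  the velocity would be orthogonal to all three, against nondegeneracy of the metric.\<close>

lemma b_nonzero:
  assumes t: "t \<in> I"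
  shows "b t \<noteq> 0"
proof
  assume b: "b t = 0"
  note p = curve_in_carrier[OF t] and v = velocity_tangent[OF t] and sub = subspace_tangent_space
  note x = xi_tangent[OF p] and fv = phi_tangent[OF p v]
    and le = lin_eta[OF p] subspace_tangent_space and lf = lin_phi[OF p] subspace_tangent_space
  obtain c where c: "c \<in> charts_at A (C t)" using ex_chart_at[OF p] by blast
  let ?f = "\<phi> (C t) (vel t)" and ?x = "\<xi> (C t)"
  define Z where "Z = (\<lambda>r::real^3. (r$1) *\<^sub>R vel t + ((r$2) *\<^sub>R ?f + (r$3) *\<^sub>R ?x))"
  define L where "L = (\<lambda>r. Z r c)"
  have ZT: "Z r \<in> T (C t)" "(r$2) *\<^sub>R ?f + (r$3) *\<^sub>R ?x \<in> T (C t)" for r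
    unfolding Z_def by (intro subspace_add[OF sub] subspace_scale[OF sub] v fv x)+
  have "linear L"
  proof (rule linearI)
    show "L (r + s) = L r + L s" for r s
      by (simp add: L_def Z_def algebra_simps)
    show "L (k *\<^sub>R r) = k *\<^sub>R L r" for k r
      by (simp add: L_def Z_def algebra_simps)
  qed
  moreover have "r = 0" if "L r = 0" for r
  proof -
    have Z: "Z r = 0"
      by (rule tangent_eqI[OF ZT(1) subspace_0[OF sub] c]) (use that in \<open>simp add: L_def\<close>)
    have "\<eta> (C t) (Z r) = r$3"
      unfolding Z_def lin_on_add[OF le subspace_scale[OF sub v] ZT(2)]
        lin_on_add[OF le subspace_scale[OF sub fv] subspace_scale[OF sub x]]
        lin_on_scaleR[OF le v] lin_on_scaleR[OF le fv] lin_on_scaleR[OF le x]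
      by (simp add: eta_vel[OF t] eta_phi[OF p v] eta_xi[OF p])
    then have r3: "r$3 = 0" unfolding Z lin_on_0[OF le] ..
    have Z1: "(r$1) *\<^sub>R vel t + (r$2) *\<^sub>R ?f = 0"
      using Z unfolding Z_def r3 by (simp only: scaleR_zero_left add_0_right)
    have "\<phi> (C t) ((r$1) *\<^sub>R vel t + (r$2) *\<^sub>R ?f) = (r$1) *\<^sub>R ?f + (r$2) *\<^sub>R (- vel t)"
      unfolding lin_on_add[OF lf subspace_scale[OF sub v] subspace_scale[OF sub fv]]
        lin_on_scaleR[OF lf v] lin_on_scaleR[OF lf fv] phi_phi[OF p v] eta_vel[OF t]
      by (simp only: scaleR_zero_left add_0_right)
    then have Z2: "(r$1) *\<^sub>R ?f + (r$2) *\<^sub>R (- vel t) = 0" unfolding Z1 lin_on_0[OF lf] ..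
    \<comment> \<open>eliminating the second vector from the two relations leaves a multiple of the first\<close>
    have elim: "(x * x + y * y) *\<^sub>R u = x *\<^sub>R (x *\<^sub>R u + y *\<^sub>R w) - y *\<^sub>R (x *\<^sub>R w + y *\<^sub>R (- u))"
      for x y and u w :: "'z::real_vector" by (simp add: algebra_simps)
    have "(r$1 * r$1 + r$2 * r$2) *\<^sub>R vel t = 0"
      unfolding elim[of _ _ _ ?f] Z1 Z2 by (simp only: scaleR_zero_right diff_zero)
    then have "r$1 * r$1 + r$2 * r$2 = 0" using vel_nonzero[OF t] by (metis scaleR_eq_0_iff)
    then have "r$1 = 0" "r$2 = 0" by (simp_all add: sum_squares_eq_zero_iff)
    with r3 show "r = 0" by (simp add: vec_eq_iff forall_3)
  qed
  ultimately have "surj L"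
    using linear_injective_0 linear_injective_imp_surjective by blast
  have "g (C t) (vel t) w = 0" if w: "w \<in> T (C t)" for w
  proof -
    obtain r where "w c = L r" using \<open>surj L\<close> by (rule surjE)
    then have wZ: "w = Z r" by (intro tangent_eqI[OF w ZT(1) c]) (simp only: L_def)
    have "g (C t) (vel t) (Z r) = (r$1) * g (C t) (vel t) (vel t) +
        1 * g (C t) (vel t) ((r$2) *\<^sub>R ?f + (r$3) *\<^sub>R ?x)"
      using metric_right[OF p v ZT(2) v, of "r$1" 1 r] unfolding Z_def scaleR_one .
    also have "g (C t) (vel t) ((r$2) *\<^sub>R ?f + (r$3) *\<^sub>R ?x) = 0"
      unfolding metric_right[OF p fv x v] metric_phi_vel[OF t] b by simp
    finally show ?thesis unfolding wZ metric_vel_vel[OF t] by simp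
  qed
  then show False using metric_nondegenerate[OF p v] vel_nonzero[OF t] by blast
qed

lemma cov_vel_tangent:
  assumes t: "t \<in> I"
  shows "cov vel t \<in> T (C t)"
proof -
  obtain c where c: "c \<in> charts_at A (C t)" using ex_chart_at[OF curve_in_carrier[OF t]] by blast
  obtain d where d: "((\<lambda>s. vel s c) has_vector_derivative d) (at t within I)"
    using velocity_differentiable[OF t c] by blast
  show ?thesis
    by (rule cov_deriv_along_tangent[of t c vel, OF t c _ d]) (rule ballI, rule velocity_tangent)
qed

text \<open>Differentiating \<^term>\<open>g (C t) (vel t) (\<xi> (C t)) = 0\<close> along the curve.\<close>

lemma metric_cov_vel_xi:
  assumes t: "t \<in> I"
  shows "g (C t) (cov vel t) (\<xi> (C t)) = b t"
proof -
  note p = curve_in_carrier[OF t] and v = velocity_tangent[OF t]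
  note fv = phi_tangent[OF p v]
  obtain c where c: "c \<in> charts_at A (C t)" using ex_chart_at[OF p] by blast
  obtain d where d: "((\<lambda>s. vel s c) has_vector_derivative d) (at t within I)"
    using velocity_differentiable[OF t c] by blast
  have vT: "\<forall>s\<in>I. vel s \<in> T (C s)" and xT: "\<forall>s\<in>I. \<xi> (C s) \<in> T (C s)"
    using velocity_tangent xi_tangent curve_in_carrier by blast+
  have "((\<lambda>s. g (C s) (vel s) (\<xi> (C s))) has_vector_derivative
      g (C t) (cov vel t) (\<xi> (C t)) + g (C t) (vel t) (cov (\<lambda>s. \<xi> (C s)) t)) (at t within I)"
    by (rule metric_compatible_along[OF t c vT xT d
          field_component_along[OF open_in_carrier xi_smooth t p c]])
  then have "((\<lambda>s. 0) has_vector_derivative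
      g (C t) (cov vel t) (\<xi> (C t)) + g (C t) (vel t) (cov (\<lambda>s. \<xi> (C s)) t)) (at t within I)"
    by (rule has_vector_derivative_transform[OF t, rotated]) (simp only: metric_phi_vel(5))
  from vector_derivative_unique[OF t this has_vector_derivative_const]
  have "g (C t) (cov vel t) (\<xi> (C t)) + g (C t) (vel t) (- \<phi> (C t) (vel t)) = 0"
    unfolding cov_deriv_along_xi[OF t] .
  moreover have "g (C t) (vel t) (- \<phi> (C t) (vel t)) = - b t"
    unfolding lin_on_neg[OF lin_metric_right[OF p v] subspace_tangent_space fv]
      metric_phi_vel(1)[OF t] ..
  ultimately show ?thesis by linarith
qed

text \<open>Along a Legendre null curve the correction term in the derivative of \<^term>\<open>\<phi>\<close> vanishes, so
  \<^term>\<open>\<phi>\<close> commutes with differentiation of the velocity; as it is also symmetric, the two summands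
  of the product rule agree.\<close>

lemma b_has_derivative:
  assumes t: "t \<in> I"
  shows "(b has_vector_derivative 2 * g (C t) (cov vel t) (\<phi> (C t) (vel t))) (at t within I)"
proof -
  note p = curve_in_carrier[OF t] and v = velocity_tangent[OF t] and cT = cov_vel_tangent[OF t]
  note fv = phi_tangent[OF p v]
  obtain c where c: "c \<in> charts_at A (C t)" using ex_chart_at[OF p] by blast
  obtain d where d: "((\<lambda>s. vel s c) has_vector_derivative d) (at t within I)"
    using velocity_differentiable[OF t c] by blast
  have vT: "\<forall>s\<in>I. vel s \<in> T (C s)" and fT: "\<forall>s\<in>I. \<phi> (C s) (vel s) \<in> T (C s)"
    using velocity_tangent phi_tangent curve_in_carrier by blast+
  obtain e where e: "((\<lambda>s. \<phi> (C s) (vel s) c) has_vector_derivative e) (at t within I)"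
    using cov_deriv_along_phi(2)[OF t c vT d] by blast
  have "cov (\<lambda>s. \<phi> (C s) (vel s)) t = \<phi> (C t) (cov vel t)"
    unfolding cov_deriv_along_phi(1)[OF t c vT d] metric_vel_vel[OF t] eta_vel[OF t]
    by (simp only: mult_zero_right scaleR_zero_left minus_zero diff_zero add_0_right)
  then have "((\<lambda>s. g (C s) (vel s) (\<phi> (C s) (vel s))) has_vector_derivative
      g (C t) (cov vel t) (\<phi> (C t) (vel t)) + g (C t) (vel t) (\<phi> (C t) (cov vel t)))
      (at t within I)"
    using metric_compatible_along[OF t c vT fT d e] by (simp only:)
  moreover have "g (C t) (vel t) (\<phi> (C t) (cov vel t)) = g (C t) (cov vel t) (\<phi> (C t) (vel t))"
    using metric_phi_sym[OF p v cT] metric_sym[OF p fv cT] by (simp only:)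
  moreover have "b = (\<lambda>s. g (C s) (vel s) (\<phi> (C s) (vel s)))" by (rule ext) (simp only: b_fun_def)
  ultimately show ?thesis by simp
qed

text \<open>The scalar product of the first Frenet equation with \<^term>\<open>\<xi>\<close>.  The coefficients
  \<^term>\<open>h\<close> and \<^term>\<open>r\<close> drop out because the velocity is orthogonal to \<^term>\<open>\<xi>\<close>.\<close>

lemma first_curvature:
  assumes t: "t \<in> I" and \<sigma>: "\<sigma> * \<sigma> = 1"
    and w: "w = \<sigma> *\<^sub>R (\<xi> (C t) + r *\<^sub>R vel t)"
    and eq: "cov vel t = h *\<^sub>R vel t + k *\<^sub>R w"
  shows "k = \<sigma> * b t"
proof -
  note p = curve_in_carrier[OF t] and v = velocity_tangent[OF t]
  note x = xi_tangent[OF p]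
  have w': "w = \<sigma> *\<^sub>R \<xi> (C t) + (\<sigma> * r) *\<^sub>R vel t"
    unfolding w by (simp only: scaleR_add_right scaleR_scaleR)
  have wT: "w \<in> T (C t)"
    unfolding w' by (intro subspace_add subspace_scale subspace_tangent_space x v)
  have "b t = h * g (C t) (vel t) (\<xi> (C t)) + k * g (C t) (w) (\<xi> (C t))"
    using metric_cov_vel_xi[OF t] unfolding eq metric_left[OF p v wT x] by simp
  also have "g (C t) (w) (\<xi> (C t)) = \<sigma>"
    unfolding w' metric_left[OF p x v x] metric_phi_vel[OF t] by simp
  finally have "b t = k * \<sigma>" unfolding metric_phi_vel[OF t] by simp
  then show ?thesis using \<sigma> by (simp add: algebra_simps)
qed

text \<open>If \<^term>\<open>b\<close> is constant then \<^term>\<open>W\<close> is \<^term>\<open>\<xi>\<close> up to a sign, and its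
  derivative is isotropic.  By the third Frenet equation the square of this derivative is
  \<^term>\<open>2 * k1 t * k2 t\<close>, while \<^term>\<open>k1 t\<close> is not zero.  The derivative of \<^term>\<open>b\<close>, computed
  from the first Frenet equation, is \<^term>\<open>2 * h t * b t\<close>.\<close>

lemma curvatures_of_constant_b:
  assumes frame: "frenet_frame A g I C N W" and eqs: "frenet_equations A nabla I C N W h k1 k2"
    and \<sigma>: "\<sigma> * \<sigma> = 1"
    and W: "\<And>t. t \<in> I \<Longrightarrow> W t =
      \<sigma> *\<^sub>R (\<xi> (C t) + (vector_derivative b (at t within I) / (2 * (b t)\<^sup>2)) *\<^sub>R vel t)"
    and const: "\<And>t. t \<in> I \<Longrightarrow> b t = b0"
    and t: "t \<in> I"
  shows "h t = 0" and "k2 t = 0"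
proof -
  note p = curve_in_carrier[OF t] and v = velocity_tangent[OF t]
  note x = xi_tangent[OF p] and fv = phi_tangent[OF p v]
  have b': "(b has_vector_derivative 0) (at s within I)" if s: "s \<in> I" for s
    by (rule has_vector_derivative_transform[OF s _ has_vector_derivative_const]) (rule const)
  have Wxi: "W s = \<sigma> *\<^sub>R \<xi> (C s)" if s: "s \<in> I" for s
    unfolding W[OF s] vector_derivative_within[OF within_nontrivial[OF s] b'[OF s]]
    by (simp only: div_0 scaleR_zero_left add_0_right)
  have F: "cov vel t = h t *\<^sub>R vel t + k1 t *\<^sub>R W t"
    "cov W t = - k2 t *\<^sub>R vel t - k1 t *\<^sub>R N t"
    using eqs t unfolding frenet_equations_def by blast+
  have NT: "N t \<in> T (C t)" and N: "g (C t) (vel t) (N t) = 1" "g (C t) (N t) (N t) = 0"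
    using frame t unfolding frenet_frame_def smooth_field_along_def by blast+
  have k1: "k1 t = \<sigma> * b t" by (rule first_curvature[OF t \<sigma> W[OF t] F(1)])
  have "g (C t) (cov vel t) (\<phi> (C t) (vel t)) = 0"
    using vector_derivative_unique[OF t b_has_derivative[OF t] b'[OF t]] by simp
  then have "h t * b t + k1 t * \<sigma> * 0 = 0"
    unfolding F Wxi[OF t] scaleR_scaleR metric_left[OF p v x fv] metric_phi_vel[OF t] .
  then show "h t = 0" using b_nonzero[OF t] by simp
  have "cov W t = (\<Sum>i\<in>{()}. 0 *\<^sub>R \<xi> (C t) + \<sigma> *\<^sub>R nabla (C t) (vel t) \<xi>)"
  proof (rule cov_deriv_along_Leibniz(1)[OF _ open_in_carrier t p])
    \<comment> \<open>the Leibniz rule is used with a single field, indexed by the unit type\<close>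
    have sum1: "(\<Sum>i\<in>{()}. F i) = F ()" for F :: "unit \<Rightarrow> 'z::comm_monoid_add" by simp
    show "W s = (\<Sum>i\<in>{()}. \<sigma> *\<^sub>R \<xi> (C s))" if "s \<in> I" for s
      unfolding sum1 by (rule Wxi[OF that])
  qed (simp_all add: xi_smooth)
  also have "\<dots> = \<sigma> *\<^sub>R cov (\<lambda>s. \<xi> (C s)) t"
    unfolding cov_deriv_along_field[OF open_in_carrier xi_smooth t p] by simp
  also have "\<dots> = \<sigma> *\<^sub>R (- \<phi> (C t) (vel t))" unfolding cov_deriv_along_xi[OF t] ..
  finally have covW: "(- \<sigma>) *\<^sub>R \<phi> (C t) (vel t) + 0 *\<^sub>R \<phi> (C t) (vel t) =
      (- k2 t) *\<^sub>R vel t + (- k1 t) *\<^sub>R N t"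
    unfolding F by (simp only: scaleR_minus_left scaleR_minus_right scaleR_zero_left add_0_right
        diff_conv_add_uminus)
  have T': "(- k2 t) *\<^sub>R vel t + (- k1 t) *\<^sub>R N t \<in> T (C t)"
    by (intro subspace_add subspace_scale subspace_tangent_space v NT)
  have fT: "(- \<sigma>) *\<^sub>R \<phi> (C t) (vel t) + 0 *\<^sub>R \<phi> (C t) (vel t) \<in> T (C t)"
    by (intro subspace_add subspace_scale subspace_tangent_space fv)
  have "0 = g (C t) ((- \<sigma>) *\<^sub>R \<phi> (C t) (vel t) + 0 *\<^sub>R \<phi> (C t) (vel t))
      ((- \<sigma>) *\<^sub>R \<phi> (C t) (vel t) + 0 *\<^sub>R \<phi> (C t) (vel t))"
    unfolding metric_left[OF p fv fv fT] metric_right[OF p fv fv fv] metric_phi_vel(3)[OF t] by simp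
  also have "\<dots> = 2 * k1 t * k2 t"
    unfolding covW metric_left[OF p v NT T'] metric_right[OF p v NT v] metric_right[OF p v NT NT]
      metric_sym[OF p NT v] metric_vel_vel[OF t] N by simp
  finally show "k2 t = 0" using k1 b_nonzero[OF t] \<sigma> by auto
qed

end

section \<open>Curvatures of the Frenet frame\<close>

theorem proposition4p5:
  fixes A :: "('m::{t2_space, second_countable_topology}, real^3) chart set"
    and \<phi> :: "'m \<Rightarrow> ('m, real^3) tvec \<Rightarrow> ('m, real^3) tvec"
    and \<xi> :: "'m \<Rightarrow> ('m, real^3) tvec"
    and \<eta> :: "'m \<Rightarrow> ('m, real^3) tvec \<Rightarrow> real"
    and g :: "'m \<Rightarrow> ('m, real^3) tvec \<Rightarrow> ('m, real^3) tvec \<Rightarrow> real"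
    and nabla :: "'m \<Rightarrow> ('m, real^3) tvec \<Rightarrow> ('m \<Rightarrow> ('m, real^3) tvec) \<Rightarrow> ('m, real^3) tvec"
    and I :: "real set" and C :: "real \<Rightarrow> 'm"
    and N W :: "real \<Rightarrow> ('m, real^3) tvec"
    and b h k1 k2 :: "real \<Rightarrow> real"
    and \<epsilon> \<epsilon>1 :: real
  assumes "smooth_atlas A"
    and "almost_contact_B_metric A \<phi> \<xi> \<eta> g"
    and "levi_civita A g nabla"
    and "sasaki_like A \<phi> \<xi> \<eta> g nabla"
    and "null_curve A g I C"
    and "legendre_curve A \<eta> I C"
    and "b = b_fun A \<phi> g I C"
    and "\<epsilon> \<in> {1, -1}" and "\<epsilon>1 \<in> {1, -1}"
    and "frenet_frame A g I C N W"
    and "\<And>t. t \<in> I \<Longrightarrow> W t = (\<epsilon>1 * \<epsilon>) *\<^sub>R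
           (\<xi> (C t) + (vector_derivative b (at t within I) / (2 * (b t)\<^sup>2)) *\<^sub>R velocity A I C t)"
    and "frenet_equations A nabla I C N W h k1 k2"
  shows "(k1 constant_on I \<and> k2 constant_on I \<longleftrightarrow> (\<exists>b0. b0 \<noteq> 0 \<and> (\<forall>t\<in>I. b t = b0))) \<and>
         ((\<exists>b0. b0 \<noteq> 0 \<and> (\<forall>t\<in>I. b t = b0)) \<longrightarrow> (\<forall>t\<in>I. k2 t = 0)) \<and>
         (null_cubic A g nabla I C N W \<longleftrightarrow> (\<forall>t\<in>I. \<epsilon>1 * \<epsilon> * b t = 1))"
proof -
  have curve: "smooth_curve A I C" using assms(5) unfolding null_curve_def by blast
  have conn: "affine_connection A nabla" using assms(3) unfolding levi_civita_def by blast
  have metric: "pseudo_riemannian_metric A g"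
    using assms(2) unfolding almost_contact_B_metric_def by blast
  interpret legendre_null_curve A I C nabla g \<phi> \<xi> \<eta>
    by unfold_locales (fact assms(1) curve conn metric assms(3) assms(2) assms(4) assms(5) assms(6))+
  note b = assms(7) and frame = assms(10) and eqs = assms(12)
  define \<sigma> where "\<sigma> = \<epsilon>1 * \<epsilon>"
  have \<sigma>: "\<sigma> * \<sigma> = 1" using assms(8,9) by (auto simp: \<sigma>_def)
  note W = assms(11)[folded \<sigma>_def]
  have F: "cov_deriv_along A nabla I C (velocity A I C) t =
      h t *\<^sub>R velocity A I C t + k1 t *\<^sub>R W t" if "t \<in> I" for t
    using eqs that unfolding frenet_equations_def by blast
  have k1: "k1 t = \<sigma> * b t" if "t \<in> I" for t
    unfolding b by (rule first_curvature[OF that \<sigma> W[OF that] F[OF that]])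
  have nz: "b t \<noteq> 0" if "t \<in> I" for t
    unfolding b by (rule b_nonzero[OF that])
  have const: "h t = 0 \<and> k2 t = 0" if "\<And>s. s \<in> I \<Longrightarrow> b s = b0" and "t \<in> I" for b0 t
    using curvatures_of_constant_b[OF frame eqs \<sigma> W[unfolded b] that(1)[unfolded b] that(2)] by blast
  obtain t0 where t0: "t0 \<in> I"
    using curve interior_subset unfolding smooth_curve_def by blast
  have i: "k1 constant_on I \<and> k2 constant_on I \<longleftrightarrow> (\<exists>b0. b0 \<noteq> 0 \<and> (\<forall>t\<in>I. b t = b0))"
  proof
    assume "k1 constant_on I \<and> k2 constant_on I"
    then obtain k where k: "\<And>t. t \<in> I \<Longrightarrow> k1 t = k" unfolding constant_on_def by blast
    have "b t = \<sigma> * k" if "t \<in> I" for t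
    proof -
      have "\<sigma> * k = (\<sigma> * \<sigma>) * b t" unfolding k[OF that, symmetric] k1[OF that] by simp
      then show ?thesis using \<sigma> by simp
    qed
    then show "\<exists>b0. b0 \<noteq> 0 \<and> (\<forall>t\<in>I. b t = b0)" using nz[OF t0] t0 by metis
  next
    assume "\<exists>b0. b0 \<noteq> 0 \<and> (\<forall>t\<in>I. b t = b0)"
    then obtain b0 where b0: "\<And>t. t \<in> I \<Longrightarrow> b t = b0" by blast
    have "\<forall>t\<in>I. k1 t = \<sigma> * b0" "\<forall>t\<in>I. k2 t = 0" using k1 b0 const[of b0] by simp_all
    then show "k1 constant_on I \<and> k2 constant_on I" unfolding constant_on_def by blast
  qed
  have ii: "(\<exists>b0. b0 \<noteq> 0 \<and> (\<forall>t\<in>I. b t = b0)) \<longrightarrow> (\<forall>t\<in>I. k2 t = 0)"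
    using const by blast
  have iii: "null_cubic A g nabla I C N W \<longleftrightarrow> (\<forall>t\<in>I. \<epsilon>1 * \<epsilon> * b t = 1)"
  proof
    assume "null_cubic A g nabla I C N W"
    then have cubic: "frenet_equations A nabla I C N W (\<lambda>t. 0) (\<lambda>t. 1) (\<lambda>t. 0)"
      unfolding null_cubic_def null_Cartan_helix_def null_Cartan_curve_def by blast
    show "\<forall>t\<in>I. \<epsilon>1 * \<epsilon> * b t = 1"
    proof
      fix t assume t: "t \<in> I"
      have "cov_deriv_along A nabla I C (velocity A I C) t = 0 *\<^sub>R velocity A I C t + 1 *\<^sub>R W t"
        using cubic t unfolding frenet_equations_def by blast
      from first_curvature[OF t \<sigma> W[OF t] this]
      show "\<epsilon>1 * \<epsilon> * b t = 1" by (simp only: b \<sigma>_def)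
    qed
  next
    assume one: "\<forall>t\<in>I. \<epsilon>1 * \<epsilon> * b t = 1"
    have b_eq: "b t = \<sigma>" if "t \<in> I" for t
    proof -
      have "b t = \<sigma> * (\<sigma> * b t)" using \<sigma> by (simp flip: mult.assoc)
      then show ?thesis using one that by (simp add: \<sigma>_def)
    qed
    have "frenet_equations A nabla I C N W (\<lambda>t. 0) (\<lambda>t. 1) (\<lambda>t. 0)"
      unfolding frenet_equations_def
    proof
      fix t assume t: "t \<in> I"
      have "h t = 0" "k2 t = 0" using const[of \<sigma>] b_eq t by blast+
      moreover have "k1 t = 1" using k1[OF t] b_eq[OF t] \<sigma> by simp
      ultimately show "cov_deriv_along A nabla I C (velocity A I C) t =
          0 *\<^sub>R velocity A I C t + 1 *\<^sub>R W t \<and>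
        cov_deriv_along A nabla I C N t = - 0 *\<^sub>R N t + 0 *\<^sub>R W t \<and>
        cov_deriv_along A nabla I C W t = - 0 *\<^sub>R velocity A I C t - 1 *\<^sub>R N t"
        using bspec[OF eqs[unfolded frenet_equations_def] t] by (simp only:)
    qed
    then show "null_cubic A g nabla I C N W"
      unfolding null_cubic_def null_Cartan_helix_def null_Cartan_curve_def using frame by blast
  qed
  show ?thesis using i ii iii by blast
qed

end
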